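(* Let $\mathcal{H}$ be a separable Hilbert space with orthonormal basis $\{e_j\}_{j\in\mathbb{N}}$. Let $\mathcal{E}=\{T\in\mathcal{B}(\mathcal{H}) : T \text{ is compact}\}$, let $\mathcal{F}$ denote the family of closed subsets of $\mathbb{C}$, and let $\Xi:\mathcal{E}\to\mathcal{F}$ be defined by $\Xi(T)=\sigma(T)$, the spectrum of $T$. Then the Solvability Complexity Index of $\Xi$ (with respect to the basis $\{e_j\}$) satisfies $\mathrm{SCI}(\Xi)=1$.
   Context: $\mathcal{B}(\mathcal{H})$ is the set of bounded linear operators and $\mathcal{C}(\mathcal{H})$ the set of densely defined closed linear operators on $\mathcal{H}$; $\mathcal{D}(T)$ is the domain of $T$. Attouch-Wets metric: for closed $\Sigma,\Lambda\subset\mathbb{C}$, $$d_{\mathrm{AW}}(\Sigma,\Lambda)=\sum_{i=1}^\infty 2^{-i}\min\Big\{1,\sup_{|x|<i}|d(x,\Sigma)-d(x,\Lambda)|\Big\},\qquad d(x,\Lambda)=\inf_{\rho\in\Lambda}|\rho-x|.$$ On bounded sets this is equivalent to the Hausdorff metric. Estimating functions. Let $\{e_j\}_{j\in\mathbb{N}}$ be a fixed orthonormal basis of $\mathcal{H}$, let $\Upsilon=\{T\in\mathcal{C}(\mathcal{H}):\mathrm{span}\{e_j\}_{j\in\mathbb{N}}\subset\mathcal{D}(T)\}$, let $\mathcal{E}\subset\Upsilon$ and $\Xi:\mathcal{E}\to\mathcal{F}$, where $\mathcal{F}$ is the family of closed subsets of $\mathbb{C}$. Put $$\Pi_{\mathcal{E}}=\{\{x_{ij}\}_{i,j\in\mathbb{N}}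 : \exists\, T\in\mathcal{E},\ x_{ij}=\langle Te_j,e_i\rangle\}.$$ A set of estimating functions of order $k$ for $\Xi$ is a family of functions $$\Gamma_{n_1}:\Pi_{\mathcal{E}}\to\mathcal{F},\quad \Gamma_{n_1,n_2}:\Pi_{\mathcal{E}}\to\mathcal{F},\ \dots,\ \Gamma_{n_1,\dots,n_{k-1}}:\Pi_{\mathcal{E}}\to\mathcal{F},$$ $$\Gamma_{n_1,\dots,n_k}:\big\{\{x_{ij}\}_{i,j\le N(n_1,\dots,n_k)} : \{x_{ij}\}_{i,j\in\mathbb{N}}\in\Pi_{\mathcal{E}}\big\}\to\mathcal{F},$$ where $N(n_1,\dots,n_k)<\infty$ depends on $n_1,\dots,n_k$, such that: (i) the evaluation of $\Gamma_{n_1,\dots,n_k}(\{x_{ij}\})$ requires only finitely many arithmetic operations and radicals of the elements $\{x_{ij}\}_{i,j\le N(n_1,\dots,n_k)}$; (ii) for every $T\in\mathcal{E}$ with $x_{ij}=\langle Te_j,e_i\rangle$, in the Attouch-Wets metric, $$\Xi(T)=\lim_{n_1\to\infty}\Gamma_{n_1}(\{x_{ij}\}),\quad \Gamma_{n_1}(\{x_{ij}\})=\lim_{n_2\to\infty}\Gamma_{n_1,n_2}(\{x_{ij}\}),\ \dots,\ \Gamma_{n_1,\dots,n_{k-1}}(\{x_{ij}\})=\lim_{n_k\to\infty}\Gamma_{n_1,\dots,n_k}(\{x_{ij}\}).$$ (For $k=1$ there is a single family $\Gamma_{n_1}$ depending on finitely many matrix elements, satisfying (i) and converging to $\Xi(T)$.)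 Solvability Complexity Index. $\mathrm{SCI}(\Xi)=0$ if there is a function $\Gamma$ on $\Pi_{\mathcal{E}}$ with $\Gamma(\{x_{ij}\})=\Xi(T)$ whose evaluation requires only finitely many arithmetic operations and radicals of a finite subset of $\{x_{ij}\}$. Otherwise $\mathrm{SCI}(\Xi)$ is the smallest integer $k$ for which there exists a set of estimating functions of order $k$ for $\Xi$, and it is infinite if no set of estimating functions exists. *)

theory Defs
  imports "HOL-Analysis.Analysis" "HOL-Library.Extended_Nat" "HOL-Library.Extended_Real"
begin

section \<open>Complex Hilbert spaces and their operators\<close>

text \<open>
  The distribution only has real inner product spaces. A complex Hilbert space is a Banach space
  with a complex scalar multiplication extending the real one and a sesquilinear inner product,
  linear in the first argument, inducing the norm. Definiteness is inherited from the norm and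
  completeness from \<^class>\<open>banach\<close>.
\<close>

class complex_hilbert = banach +
  fixes scaleC :: "complex \<Rightarrow> 'a \<Rightarrow> 'a"  (infixr "*\<^sub>C" 75)
    and cinner :: "'a \<Rightarrow> 'a \<Rightarrow> complex"
  assumes scaleC_add_right: "a *\<^sub>C (x + y) = a *\<^sub>C x + a *\<^sub>C y"
    and scaleC_add_left: "(a + b) *\<^sub>C x = a *\<^sub>C x + b *\<^sub>C x"
    and scaleC_scaleC: "a *\<^sub>C b *\<^sub>C x = (a * b) *\<^sub>C x"
    and scaleC_of_real: "complex_of_real r *\<^sub>C x = r *\<^sub>R x"
    and cinner_commute: "cinner x y = cnj (cinner y x)"
    and cinner_add_left: "cinner (x + y) z = cinner x z + cinner y z"
    and cinner_scaleC_left: "cinner (a *\<^sub>C x) y = a * cinner x y"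
    and cinner_self: "cinner x x = complex_of_real ((norm x)\<^sup>2)"

definition orthonormal_basis :: "(nat \<Rightarrow> 'a::complex_hilbert) \<Rightarrow> bool" where
  "orthonormal_basis e \<longleftrightarrow>
     (\<forall>i j. cinner (e i) (e j) = (if i = j then 1 else 0)) \<and>
     closure (module.span (*\<^sub>C) (range e)) = UNIV"

definition bounded_clinear :: "('a::complex_hilbert \<Rightarrow> 'a) \<Rightarrow> bool" where
  "bounded_clinear T \<longleftrightarrow> bounded_linear T \<and> (\<forall>a x. T (a *\<^sub>C x) = a *\<^sub>C T x)"

definition compact_operator :: "('a::complex_hilbert \<Rightarrow> 'a) \<Rightarrow> bool" where
  "compact_operator T \<longleftrightarrow> bounded_clinear T \<and> compact (closure (T ` cball 0 1))"

definition spectrum :: "('a::complex_hilbert \<Rightarrow> 'a) \<Rightarrow> complex set" where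
  "spectrum T = {z. \<not> (\<exists>S. bounded_clinear S \<and>
     (\<forall>x. S (T x - z *\<^sub>C x) = x) \<and> (\<forall>x. T (S x) - z *\<^sub>C S x = x))}"


section \<open>The Attouch-Wets metric\<close>

text \<open>
  Distances are extended reals, so that the distance to the empty set is infinite (for
  \<^const>\<open>infdist\<close> it would be zero). The case distinction in \<open>ext_gap\<close> only serves to make the
  difference of two infinite distances zero.
\<close>

definition ext_dist :: "complex \<Rightarrow> complex set \<Rightarrow> ereal" where
  "ext_dist x A = (INF \<rho>\<in>A. ereal (norm (\<rho> - x)))"

definition ext_gap :: "ereal \<Rightarrow> ereal \<Rightarrow> ereal" where
  "ext_gap a b = (if a = b then 0 else \<bar>a - b\<bar>)"

definition attouch_wets :: "complex set \<Rightarrow> complex set \<Rightarrow> real" where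
  "attouch_wets A B = (\<Sum>m. (1/2) ^ Suc m * real_of_ereal
     (min 1 (SUP x\<in>{x. norm x < real (Suc m)}. ext_gap (ext_dist x A) (ext_dist x B))))"

definition aw_tendsto :: "(nat \<Rightarrow> complex set) \<Rightarrow> complex set \<Rightarrow> bool" where
  "aw_tendsto A L \<longleftrightarrow> (\<lambda>n. attouch_wets (A n) L) \<longlonglongrightarrow> 0"


section \<open>Finitely many arithmetic operations and radicals\<close>

type_synonym inf_matrix = "nat \<Rightarrow> nat \<Rightarrow> complex"

text \<open>
  The computational model is that of finite algebraic computation trees. Complex numbers are
  handled as pairs of reals, so that conjugation is available and real parts can be compared.
  The only constants are rational. A tree reads finitely many matrix entries, branches finitely
  often, and returns a finite (possibly empty) set of computed numbers.
\<close>

datatype arith =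
    Entry nat nat
  | Const rat
  | Plus arith arith
  | Minus arith arith
  | Times arith arith
  | Divide arith arith
  | Conj arith
  | Radical nat arith

text \<open>\<open>Radical n\<close> is the principal \<open>(n+1)\<close>-st root; recall that \<open>0 powr a = 0\<close>.\<close>

primrec arith_val :: "inf_matrix \<Rightarrow> arith \<Rightarrow> complex" where
  "arith_val x (Entry i j) = x i j"
| "arith_val x (Const q) = of_rat q"
| "arith_val x (Plus p q) = arith_val x p + arith_val x q"
| "arith_val x (Minus p q) = arith_val x p - arith_val x q"
| "arith_val x (Times p q) = arith_val x p * arith_val x q"
| "arith_val x (Divide p q) = arith_val x p / arith_val x q"
| "arith_val x (Conj p) = cnj (arith_val x p)"
| "arith_val x (Radical n p) = arith_val x p powr (1 / of_nat (Suc n))"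

datatype comp_tree =
    Output "arith list"
  | If_le arith arith comp_tree comp_tree

primrec run :: "inf_matrix \<Rightarrow> comp_tree \<Rightarrow> complex set" where
  "run x (Output ps) = arith_val x ` set ps"
| "run x (If_le p q s t) =
     (if Re (arith_val x p) \<le> Re (arith_val x q) then run x s else run x t)"

definition finitely_evaluable_on ::
    "inf_matrix set \<Rightarrow> (inf_matrix \<Rightarrow> complex set) \<Rightarrow> bool" where
  "finitely_evaluable_on X G \<longleftrightarrow> (\<exists>t. \<forall>x\<in>X. G x = run x t)"


section \<open>The Solvability Complexity Index\<close>

text \<open>
  Only classes of everywhere defined operators are considered, so that the linear span of the
  basis is contained in the domain of each operator.
\<close>

definition matrix_of :: "(nat \<Rightarrow> 'a::complex_hilbert) \<Rightarrow> ('a \<Rightarrow> 'a) \<Rightarrow> inf_matrix" where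
  "matrix_of e T = (\<lambda>i j. cinner (T (e j)) (e i))"

text \<open>The finite array \<open>(x i j)\<close> with \<open>i, j \<le> N\<close>, represented with zeros outside.\<close>

definition truncate :: "nat \<Rightarrow> inf_matrix \<Rightarrow> inf_matrix" where
  "truncate N x = (\<lambda>i j. if i \<le> N \<and> j \<le> N then x i j else 0)"

text \<open>
  The functions of a set of estimating functions of order \<open>k\<close> are \<open>\<Gamma> [n\<^sub>1, \<dots>, n\<^sub>l]\<close> for
  \<open>1 \<le> l \<le> k\<close>. The ones with \<open>l < k\<close> receive the whole matrix, those with \<open>l = k\<close> only the
  truncation of size \<open>N [n\<^sub>1, \<dots>, n\<^sub>k]\<close>. The value of \<open>\<Gamma>\<close> at other lists is irrelevant.
\<close>

definition visible :: "nat \<Rightarrow> (nat list \<Rightarrow> nat) \<Rightarrow> nat list \<Rightarrow> inf_matrix \<Rightarrow> inf_matrix" where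
  "visible k N ns x = (if length ns = k then truncate (N ns) x else x)"

definition estimating_functions ::
    "(nat \<Rightarrow> 'a::complex_hilbert) \<Rightarrow> ('a \<Rightarrow> 'a) set \<Rightarrow> (('a \<Rightarrow> 'a) \<Rightarrow> complex set) \<Rightarrow> nat \<Rightarrow>
     (nat list \<Rightarrow> nat) \<Rightarrow> (nat list \<Rightarrow> inf_matrix \<Rightarrow> complex set) \<Rightarrow> bool" where
  "estimating_functions e E \<Xi> k N \<Gamma> \<longleftrightarrow>
     1 \<le> k \<and>
     (\<forall>ns. 1 \<le> length ns \<and> length ns \<le> k \<longrightarrow>
        (\<forall>x\<in>matrix_of e ` E. closed (\<Gamma> ns (visible k N ns x)))) \<and>
     (\<forall>ns. length ns = k \<longrightarrow>
        finitely_evaluable_on (truncate (N ns) ` matrix_of e ` E) (\<Gamma> ns)) \<and>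
     (\<forall>T\<in>E. let x = matrix_of e T in
        aw_tendsto (\<lambda>n. \<Gamma> [n] (visible k N [n] x)) (\<Xi> T) \<and>
        (\<forall>ns. 1 \<le> length ns \<and> length ns < k \<longrightarrow>
           aw_tendsto (\<lambda>n. \<Gamma> (ns @ [n]) (visible k N (ns @ [n]) x)) (\<Gamma> ns (visible k N ns x))))"

definition exactly_computable ::
    "(nat \<Rightarrow> 'a::complex_hilbert) \<Rightarrow> ('a \<Rightarrow> 'a) set \<Rightarrow> (('a \<Rightarrow> 'a) \<Rightarrow> complex set) \<Rightarrow> bool" where
  "exactly_computable e E \<Xi> \<longleftrightarrow>
     (\<exists>\<Gamma>. finitely_evaluable_on (matrix_of e ` E) \<Gamma> \<and> (\<forall>T\<in>E. \<Gamma> (matrix_of e T) = \<Xi> T))"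

text \<open>The infimum of the empty set in \<^typ>\<open>enat\<close> is \<open>\<infinity>\<close>.\<close>

definition SCI ::
    "(nat \<Rightarrow> 'a::complex_hilbert) \<Rightarrow> ('a \<Rightarrow> 'a) set \<Rightarrow> (('a \<Rightarrow> 'a) \<Rightarrow> complex set) \<Rightarrow> enat" where
  "SCI e E \<Xi> =
     (if exactly_computable e E \<Xi> then 0
      else Inf {enat k |k. \<exists>N \<Gamma>. estimating_functions e E \<Xi> k N \<Gamma>})"

end

(*
  Lower bound: a tree reads finitely many entries, so it cannot tell the zero operator from the
  rank one projection onto a basis vector that it does not see.

  Upper bound: for compact T the finite sections converge to T in norm, and they still do so if
  their entries are rounded. Rounding takes finitely many comparisons with rational constants, and
  each leaf of the resulting tree may return a finite set of Gaussian rationals close to the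
  spectrum of the rounded section. It remains to see that the spectrum is continuous along such
  sequences. Upper semicontinuity is a perturbation argument. For lower semicontinuity away from
  zero split T = K + T P with P the projection onto the first m basis vectors and K small: then
  1 - w T is invertible iff an m by m determinant, holomorphic in w, does not vanish, and
  Hurwitz's theorem applies.
*)
theory Submission
  imports
    Defs
    "HOL-Complex_Analysis.Complex_Analysis"
    "HOL-Real_Asymp.Real_Asymp"
    "Jordan_Normal_Form.Determinant"
begin

text \<open>Eigenvalues of a section are roots of a polynomial, which radicals need not express. So
  nothing is solved at run time: the leaves carry constants fixed beforehand, one list for each
  rounding cell. The scales fit as follows. A section of size \<open>n\<close> has
  \<open>n^2\<close> entries, so entry errors of order \<open>n^-3\<close> cost at most order
  \<open>1/n\<close> in operator norm. A grid of step \<open>(n+1)^-3\<close> with numerators up to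
  \<open>(n+1)^4\<close> reaches out to \<open>n+1\<close>; every bounded operator is eventually in
  range, although the tree knows no bound of its norm. Norm convergence alone does not make the
  spectrum lower semicontinuous. What rescues it is that operators close to \<open>T\<close> inherit
  the small tail of \<open>T\<close> with the same \<open>m\<close>, so one determinant size serves
  the whole sequence. The parameter is \<open>w = 1 / z\<close> because \<open>1 - w K\<close> is
  then inverted by a power series on a disc around 0. That disc must contain 0 besides the
  reciprocal of the point studied: at 0 the determinant is 1, so it cannot vanish identically. The
  spectral point 0 has no reciprocal, but a section extended by zero always has 0 in its
  spectrum.\<close>

no_notation Finite_Cartesian_Product.vec_nth (infixl "$" 90)

section \<open>Complex Hilbert spaces\<close>

interpretation cscale: vector_space "(*\<^sub>C) :: complex \<Rightarrow> 'a::complex_hilbert \<Rightarrow> 'a"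
  by unfold_locales (simp_all add: scaleC_add_right scaleC_add_left scaleC_scaleC
      scaleC_of_real[of 1, simplified])

lemma cinner_scaleC_right: "cinner x (a *\<^sub>C y) = cnj a * cinner (x::'a::complex_hilbert) y"
  by (metis cinner_commute cinner_scaleC_left complex_cnj_mult)

lemma cinner_add_right: "cinner (x::'a::complex_hilbert) (y + z) = cinner x y + cinner x z"
  by (metis cinner_commute cinner_add_left complex_cnj_add)

lemma cinner_zero_left [simp]: "cinner (0::'a::complex_hilbert) y = 0"
  using cinner_scaleC_left[of 0 0 y] by simp

lemma cinner_zero_right [simp]: "cinner (y::'a::complex_hilbert) 0 = 0"
  using cinner_scaleC_right[of y 0 0] by simp

lemma cinner_minus_left: "cinner (- x::'a::complex_hilbert) y = - cinner x y"
  using cinner_scaleC_left[of "-1" x y] by simp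

lemma cinner_minus_right: "cinner (x::'a::complex_hilbert) (- y) = - cinner x y"
  using cinner_scaleC_right[of x "-1" y] by simp

lemma cinner_diff_left: "cinner (x - z::'a::complex_hilbert) y = cinner x y - cinner z y"
  using cinner_add_left[of x "- z" y] by (simp add: cinner_minus_left)

lemma cinner_diff_right: "cinner (x::'a::complex_hilbert) (y - z) = cinner x y - cinner x z"
  using cinner_add_right[of x y "- z"] by (simp add: cinner_minus_right)

lemma cinner_sum_left: "cinner (\<Sum>i\<in>I. f i) (y::'a::complex_hilbert) = (\<Sum>i\<in>I. cinner (f i) y)"
  by (induction I rule: infinite_finite_induct) (simp_all add: cinner_add_left)

lemma cinner_sum_right: "cinner (y::'a::complex_hilbert) (\<Sum>i\<in>I. f i) = (\<Sum>i\<in>I. cinner y (f i))"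
  by (induction I rule: infinite_finite_induct) (simp_all add: cinner_add_right)

lemma norm_scaleC [simp]: "norm (a *\<^sub>C x) = cmod a * norm (x::'a::complex_hilbert)"
proof -
  have "complex_of_real ((norm (a *\<^sub>C x))\<^sup>2) = a * cnj a * complex_of_real ((norm x)\<^sup>2)"
    by (metis cinner_self cinner_scaleC_left cinner_scaleC_right mult.assoc)
  also have "\<dots> = complex_of_real ((cmod a * norm x)\<^sup>2)"
    by (simp add: complex_norm_square[symmetric] power_mult_distrib)
  finally have "(norm (a *\<^sub>C x))\<^sup>2 = (cmod a * norm x)\<^sup>2"
    using of_real_eq_iff by blast
  then show ?thesis
    by (simp add: power2_eq_iff_nonneg)
qed

text \<open>Subtract from \<open>x\<close> its component along \<open>y\<close> and expand the nonnegative square.\<close>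

lemma cinner_Cauchy_Schwarz: "cmod (cinner x y) \<le> norm x * norm (y::'a::complex_hilbert)"
proof (cases "y = 0")
  case False
  define a where "a = cinner x y / complex_of_real ((norm y)\<^sup>2)"
  have y: "complex_of_real ((norm y)\<^sup>2) \<noteq> 0"
    using False by simp
  have "cinner (x - a *\<^sub>C y) (x - a *\<^sub>C y) = cinner x (x - a *\<^sub>C y) - a * cinner y (x - a *\<^sub>C y)"
    by (simp add: cinner_diff_left cinner_scaleC_left)
  also have "cinner y (x - a *\<^sub>C y) = 0"
  proof -
    have "cnj a * complex_of_real ((norm y)\<^sup>2) = cnj (a * complex_of_real ((norm y)\<^sup>2))"
      by simp
    also have "\<dots> = cinner y x"
      using y by (simp add: a_def cinner_commute[of y x])
    finally show ?thesis
      by (simp add: cinner_diff_right cinner_scaleC_right cinner_self)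
  qed
  also have "cinner x (x - a *\<^sub>C y) - a * 0
      = complex_of_real ((norm x)\<^sup>2) - cnj a * cinner x y"
    by (simp add: cinner_diff_right cinner_scaleC_right cinner_self)
  also have "cnj a * cinner x y = complex_of_real ((cmod (cinner x y))\<^sup>2 / (norm y)\<^sup>2)"
    using complex_norm_square[of "cinner x y"] by (simp add: a_def mult.commute)
  finally have "(norm (x - a *\<^sub>C y))\<^sup>2 = (norm x)\<^sup>2 - (cmod (cinner x y))\<^sup>2 / (norm y)\<^sup>2"
    unfolding cinner_self of_real_diff[symmetric] of_real_eq_iff .
  then have "(cmod (cinner x y))\<^sup>2 / (norm y)\<^sup>2 \<le> (norm x)\<^sup>2"
    by (metis diff_ge_0_iff_ge zero_le_power2)
  then have "(cmod (cinner x y))\<^sup>2 \<le> (norm x * norm y)\<^sup>2"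
    using False by (simp add: divide_le_eq power_mult_distrib)
  then show ?thesis
    by (rule power2_le_imp_le) simp
qed simp

lemma bounded_linear_cinner_left: "bounded_linear (\<lambda>x. cinner x (y::'a::complex_hilbert))"
proof (rule bounded_linear_intro[where K = "norm y"])
  fix r x show "cinner (r *\<^sub>R x) y = r *\<^sub>R cinner x y"
    by (simp add: scaleC_of_real[symmetric] cinner_scaleC_left scaleR_conv_of_real)
qed (simp_all add: cinner_add_left cinner_Cauchy_Schwarz)

lemma bounded_linear_cinner_right: "bounded_linear (\<lambda>x. cinner (y::'a::complex_hilbert) x)"
proof (rule bounded_linear_intro[where K = "norm y"])
  fix r x show "cinner y (r *\<^sub>R x) = r *\<^sub>R cinner y x"
    by (simp add: scaleC_of_real[symmetric] cinner_scaleC_right scaleR_conv_of_real)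
  fix x show "norm (cinner y x) \<le> norm x * norm y"
    using cinner_Cauchy_Schwarz[of y x] by (simp add: mult.commute)
qed (simp add: cinner_add_right)

lemma bounded_clinear_intro:
  assumes "\<And>x y. T (x + y) = T x + T y" "\<And>a x. T (a *\<^sub>C x) = a *\<^sub>C T x"
    "\<And>x. norm (T x) \<le> C * norm x"
  shows "bounded_clinear T"
  unfolding bounded_clinear_def
proof
  show "bounded_linear T"
    by (rule bounded_linear_intro[where K = C])
      (simp_all add: assms scaleC_of_real[symmetric] mult.commute)
qed (simp add: assms)

lemma bounded_clinearD:
  assumes "bounded_clinear T"
  shows "T (x + y) = T x + T y" "T (x - y) = T x - T y" "T 0 = 0" "T (- x) = - T x"
    "T (a *\<^sub>C x) = a *\<^sub>C T x" "T (\<Sum>i\<in>I. f i) = (\<Sum>i\<in>I. T (f i))"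
proof -
  interpret bounded_linear T
    using assms bounded_clinear_def by blast
  show "T (x + y) = T x + T y" "T (x - y) = T x - T y" "T 0 = 0" "T (- x) = - T x"
    "T (\<Sum>i\<in>I. f i) = (\<Sum>i\<in>I. T (f i))"
    by (simp_all add: add diff zero neg sum)
  show "T (a *\<^sub>C x) = a *\<^sub>C T x"
    using assms by (simp add: bounded_clinear_def)
qed

lemma bounded_clinear_bound:
  assumes "bounded_clinear T"
  obtains C where "0 < C" "\<And>x. norm (T x) \<le> C * norm x"
proof -
  have "bounded_linear T"
    using assms bounded_clinear_def by blast
  from bounded_linear.pos_bounded[OF this] show ?thesis
    using that by (metis mult.commute)
qed

text \<open>The shifts \<open>T - z\<close> and \<open>1 - w T\<close> are both instances, with the
  identity as one of the two operators.\<close>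

lemma bounded_clinear_diff_scaleC:
  assumes "bounded_clinear A" "bounded_clinear B"
  shows "bounded_clinear (\<lambda>x. a *\<^sub>C A x - b *\<^sub>C B x)"
proof -
  obtain C where C: "\<And>x. norm (A x) \<le> C * norm x"
    using bounded_clinear_bound[OF assms(1)] by blast
  obtain D where D: "\<And>x. norm (B x) \<le> D * norm x"
    using bounded_clinear_bound[OF assms(2)] by blast
  show ?thesis
  proof (rule bounded_clinear_intro)
    fix x show "norm (a *\<^sub>C A x - b *\<^sub>C B x) \<le> (cmod a * C + cmod b * D) * norm x"
      using norm_triangle_ineq4[of "a *\<^sub>C A x" "b *\<^sub>C B x"]
        mult_left_mono[OF C[of x] norm_ge_zero[of a]] mult_left_mono[OF D[of x] norm_ge_zero[of b]]
      by (simp add: algebra_simps)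
  qed (simp_all add: bounded_clinearD[OF assms(1)] bounded_clinearD[OF assms(2)]
      cscale.scale_right_diff_distrib cscale.scale_right_distrib mult.commute)
qed

lemma bounded_clinear_ident: "bounded_clinear (\<lambda>x. x)"
  by (rule bounded_clinear_intro[where C = 1]) simp_all

lemma bounded_clinear_scale: "bounded_clinear ((*\<^sub>C) a)"
  by (rule bounded_clinear_intro[where C = "cmod a"]) 
    (simp_all add: cscale.scale_right_distrib mult.commute)

section \<open>Regular operators and the spectrum\<close>

definition bounded_below :: "real \<Rightarrow> ('a::complex_hilbert \<Rightarrow> 'a) \<Rightarrow> bool" where
  "bounded_below c A \<longleftrightarrow> 0 < c \<and> (\<forall>x. c * norm x \<le> norm (A x))"

text \<open>Bounded invertibility, phrased by a lower bound and surjectivity because both survive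
  small perturbations with explicit constants.\<close>

definition regular :: "('a::complex_hilbert \<Rightarrow> 'a) \<Rightarrow> bool" where
  "regular A \<longleftrightarrow> (\<exists>c. bounded_below c A) \<and> surj A"

lemma bounded_below_inj:
  assumes "bounded_clinear A" "bounded_below c A"
  shows "inj A"
proof (rule injI)
  fix x y assume "A x = A y"
  then have "c * norm (x - y) \<le> 0"
    using assms(2) unfolding bounded_below_def
    by (metis bounded_clinearD(2)[OF assms(1)] eq_iff_diff_eq_0 norm_zero)
  then show "x = y"
    using assms(2) by (simp add: bounded_below_def mult_le_0_iff)
qed

abbreviation inverse_op :: "('a::complex_hilbert \<Rightarrow> 'a) \<Rightarrow> 'a \<Rightarrow> 'a" where
  "inverse_op A \<equiv> inv_into UNIV A"

lemma bounded_below_inv: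
  assumes "bounded_below c A" "surj A"
  shows "norm (inverse_op A y) \<le> norm y / c"
  using assms by (simp add: bounded_below_def pos_le_divide_eq mult.commute)
    (metis surj_f_inv_f)

text \<open>The lower bound \<open>c\<close> makes the inverse bounded by \<open>1 / c\<close>, and
  injectivity makes it linear. Conversely, a bound \<open>C\<close> of a given inverse yields the
  lower bound \<open>1 / C\<close>.\<close>

lemma regular_iff_inverse:
  assumes A: "bounded_clinear A"
  shows "regular A \<longleftrightarrow> (\<exists>S. bounded_clinear S \<and> (\<forall>x. S (A x) = x) \<and> (\<forall>x. A (S x) = x))"
proof
  assume "regular A"
  then obtain c where c: "bounded_below c A" and surj: "surj A"
    by (auto simp: regular_def)
  have inj: "inj A"
    by (rule bounded_below_inj[OF A c])
  have AS: "A (inverse_op A x) = x" for x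
    by (rule surj_f_inv_f[OF surj])
  have "bounded_clinear (inverse_op A)"
  proof (rule bounded_clinear_intro[where C = "1 / c"])
    show "inverse_op A (x + y) = inverse_op A x + inverse_op A y" for x y
      using injD[OF inj] by (metis AS bounded_clinearD(1)[OF A])
    show "inverse_op A (a *\<^sub>C x) = a *\<^sub>C inverse_op A x" for a x
      using injD[OF inj] by (metis AS bounded_clinearD(5)[OF A])
    show "norm (inverse_op A x) \<le> 1 / c * norm x" for x
      using bounded_below_inv[OF c surj, of x] by simp
  qed
  then show "\<exists>S. bounded_clinear S \<and> (\<forall>x. S (A x) = x) \<and> (\<forall>x. A (S x) = x)"
    using AS inv_f_f[OF inj] by blast
next
  assume "\<exists>S. bounded_clinear S \<and> (\<forall>x. S (A x) = x) \<and> (\<forall>x. A (S x) = x)"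
  then obtain S where S: "bounded_clinear S" "\<And>x. S (A x) = x" "\<And>x. A (S x) = x"
    by blast
  obtain C where C: "0 < C" "\<And>x. norm (S x) \<le> C * norm x"
    using bounded_clinear_bound[OF S(1)] by blast
  have "bounded_below (1 / C) A"
    using C S(2) by (simp add: bounded_below_def field_simps) (metis C(2) mult.commute)
  moreover have "surj A"
    using S(3) by (metis surjI)
  ultimately show "regular A"
    by (auto simp: regular_def)
qed

lemma bounded_clinear_shift: "bounded_clinear T \<Longrightarrow> bounded_clinear (\<lambda>x. T x - z *\<^sub>C x)"
  using bounded_clinear_diff_scaleC[of T "\<lambda>x. x" 1 z] by (simp add: bounded_clinear_ident)

lemma bounded_clinear_id_minus: "bounded_clinear T \<Longrightarrow> bounded_clinear (\<lambda>x. x - w *\<^sub>C T x)"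
  using bounded_clinear_diff_scaleC[of "\<lambda>x. x" T 1 w] by (simp add: bounded_clinear_ident)

lemma spectrum_iff_not_regular:
  assumes "bounded_clinear T"
  shows "z \<in> spectrum T \<longleftrightarrow> \<not> regular (\<lambda>x. T x - z *\<^sub>C x)"
  using regular_iff_inverse[OF bounded_clinear_shift[OF assms]]
  by (simp add: spectrum_def)

lemma regular_scale:
  assumes "bounded_clinear A" "regular A" "a \<noteq> 0"
  shows "regular (\<lambda>x. a *\<^sub>C A x)"
proof -
  obtain c where c: "0 < c" "\<And>x. c * norm x \<le> norm (A x)" and s: "surj A"
    using assms by (auto simp: regular_def bounded_below_def)
  have "bounded_below (cmod a * c) (\<lambda>x. a *\<^sub>C A x)"
    using c assms(3) mult_left_mono[OF c(2) norm_ge_zero[of a]] 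
    by (simp add: bounded_below_def mult.assoc)
  moreover have "surj (\<lambda>x. a *\<^sub>C A x)"
  proof (rule surjI)
    fix y show "a *\<^sub>C A (inverse_op A (inverse a *\<^sub>C y)) = y"
      using assms(3) by (simp add: surj_f_inv_f[OF s])
  qed
  ultimately show ?thesis
    by (auto simp: regular_def)
qed

text \<open>The two operators differ by the nonzero factor \<open>- w\<close>. This passes from
  \<open>z\<close> to its reciprocal, where power series at the origin are available.\<close>

lemma spectrum_iff_resolvent:
  assumes T: "bounded_clinear T" and "w \<noteq> 0"
  shows "inverse w \<in> spectrum T \<longleftrightarrow> \<not> regular (\<lambda>x. x - w *\<^sub>C T x)"
proof -
  have 1: "(\<lambda>x. (- w) *\<^sub>C (T x - inverse w *\<^sub>C x)) = (\<lambda>x. x - w *\<^sub>C T x)"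
    using assms(2) by (simp add: cscale.scale_right_diff_distrib)
  have 2: "(\<lambda>x. (- inverse w) *\<^sub>C (x - w *\<^sub>C T x)) = (\<lambda>x. T x - inverse w *\<^sub>C x)"
    using assms(2) by (simp add: cscale.scale_right_diff_distrib)
  show ?thesis
    using regular_scale[OF bounded_clinear_shift[OF T], of "inverse w" "- w", unfolded 1]
      regular_scale[OF bounded_clinear_id_minus[OF T], of w "- inverse w", unfolded 2] assms(2)
    by (auto simp: spectrum_iff_not_regular[OF T])
qed

text \<open>Solving \<open>B x = y\<close> means finding a fixed point of \<open>x \<mapsto> A\<^sup>-\<^sup>1 (y - (B x - A x))\<close>, which is a
  contraction.\<close>

lemma bounded_below_perturb:
  assumes A: "bounded_clinear A" and B: "bounded_clinear B"
    and c: "bounded_below c A" and surj: "surj A"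
    and d: "\<And>x. norm (B x - A x) \<le> d * norm x" "0 \<le> d" "d < c"
  shows "bounded_below (c - d) B" "surj B"
proof -
  have "(c - d) * norm x \<le> norm (B x)" for x
  proof -
    have "c * norm x \<le> norm (A x)"
      using c by (simp add: bounded_below_def)
    also have "\<dots> \<le> norm (B x) + norm (B x - A x)"
      by (metis norm_triangle_ineq3 abs_le_iff add.commute diff_le_eq norm_minus_commute)
    finally show ?thesis
      using d(1)[of x] by (simp add: algebra_simps)
  qed
  then show "bounded_below (c - d) B"
    using d by (simp add: bounded_below_def)
  have c0: "0 < c"
    using c by (simp add: bounded_below_def)
  have AS: "A (inverse_op A x) = x" for x
    by (rule surj_f_inv_f[OF surj])
  have inj: "inj A"
    by (rule bounded_below_inj[OF A c])
  have diff: "inverse_op A u - inverse_op A v = inverse_op A (u - v)" for u v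
    using injD[OF inj] by (metis AS bounded_clinearD(2)[OF A])
  show "surj B"
  proof -
    have "\<exists>x. B x = y" for y
    proof -
      define f where "f x = inverse_op A (y - (B x - A x))" for x
      have "dist (f x) (f x') \<le> d / c * dist x x'" for x x'
      proof -
        have "f x - f x' = inverse_op A (B (x' - x) - A (x' - x))"
          unfolding f_def diff
          by (simp add: bounded_clinearD(2)[OF A] bounded_clinearD(2)[OF B] algebra_simps)
        then have "norm (f x - f x') \<le> norm (B (x' - x) - A (x' - x)) / c"
          using bounded_below_inv[OF c surj] by metis
        also have "\<dots> \<le> d * norm (x' - x) / c"
          using c0 d(1) by (simp add: divide_right_mono)
        finally show ?thesis
          by (simp add: dist_norm norm_minus_commute)
      qed
      then obtain x where "f x = x"
        using banach_fix_type[of "d / c" f] d c0 by auto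
      then have "A x = y - (B x - A x)"
        using AS by (metis f_def)
      then show ?thesis
        by (auto simp: algebra_simps)
    qed
    then show ?thesis
      by (metis surjI)
  qed
qed

lemma bounded_below_scale: "z \<noteq> 0 \<Longrightarrow> bounded_below (cmod z) (\<lambda>x. z *\<^sub>C x)"
  by (simp add: bounded_below_def)

lemma surj_scale:
  assumes "z \<noteq> 0"
  shows "surj (\<lambda>x::'a::complex_hilbert. z *\<^sub>C x)"
  by (rule surjI[of _ "\<lambda>x. inverse z *\<^sub>C x"]) (use assms in simp)

text \<open>A perturbation of the identity, with lower bound 1, by an operator of norm at most
  \<open>cmod w * \<delta>\<close>.\<close>

lemma bounded_below_id_minus:
  assumes K: "bounded_clinear K" and q: "\<And>x. norm (K x) \<le> \<delta> * norm x" "0 \<le> \<delta>" "cmod w * \<delta> < 1"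
  shows "bounded_below (1 - cmod w * \<delta>) (\<lambda>x. x - w *\<^sub>C K x)" "surj (\<lambda>x. x - w *\<^sub>C K x)"
proof -
  have 1: "bounded_below 1 (\<lambda>x::'a. x)"
    by (simp add: bounded_below_def)
  have 2: "norm ((x - w *\<^sub>C K x) - x) \<le> cmod w * \<delta> * norm x" for x
    using mult_left_mono[OF q(1)[of x] norm_ge_zero[of w]] by (simp add: mult.assoc)
  have 3: "0 \<le> cmod w * \<delta>"
    using q by simp
  have 4: "surj (\<lambda>x::'a. x)"
    by simp
  show "bounded_below (1 - cmod w * \<delta>) (\<lambda>x. x - w *\<^sub>C K x)" "surj (\<lambda>x. x - w *\<^sub>C K x)"
    using bounded_below_perturb[OF bounded_clinear_ident bounded_clinear_id_minus[OF K] 1 4 2 3 q(3)]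
    by auto
qed

text \<open>If \<open>cmod z\<close> exceeds \<open>C\<close>, then \<open>T - z\<close> is a
  perturbation of the scalar \<open>- z\<close>, whose lower bound \<open>cmod z\<close> beats the
  bound of \<open>T\<close>.\<close>

lemma spectrum_norm_le:
  assumes T: "bounded_clinear T" and C: "\<And>x. norm (T x) \<le> C * norm x" "0 \<le> C"
    and z: "z \<in> spectrum T"
  shows "cmod z \<le> C"
proof (rule ccontr)
  assume "\<not> cmod z \<le> C"
  then have 1: "C < cmod (- z)" and "z \<noteq> 0"
    using C(2) by auto
  have 2: "norm ((T x - z *\<^sub>C x) - (- z) *\<^sub>C x) \<le> C * norm x" for x
    using C(1) by simp
  have "regular (\<lambda>x. T x - z *\<^sub>C x)"
    using bounded_below_perturb[OF bounded_clinear_scale bounded_clinear_shift[OF T]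
        bounded_below_scale surj_scale 2 C(2) 1] \<open>z \<noteq> 0\<close> by (auto simp: regular_def)
  then show False
    using z spectrum_iff_not_regular[OF T] by blast
qed

text \<open>The following lemma yields both that the spectrum is closed and that it is upper
  semicontinuous.\<close>

lemma spectrum_limit:
  assumes T: "bounded_clinear T" and S: "\<And>n. bounded_clinear (S n)"
    and lim: "\<And>\<epsilon>. 0 < \<epsilon> \<Longrightarrow> \<forall>\<^sub>F n in sequentially. \<forall>x. norm (S n x - T x) \<le> \<epsilon> * norm x"
    and z: "z \<longlonglongrightarrow> l" "\<And>n. z n \<in> spectrum (S n)"
  shows "l \<in> spectrum T"
proof (rule ccontr)
  assume "l \<notin> spectrum T"
  then obtain c where c: "bounded_below c (\<lambda>x. T x - l *\<^sub>C x)" and s: "surj (\<lambda>x. T x - l *\<^sub>C x)"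
    by (auto simp: spectrum_iff_not_regular[OF T] regular_def)
  then have c0: "0 < c"
    by (simp add: bounded_below_def)
  \<comment> \<open>One third of \<open>c\<close> for the operator and one third for the spectral
    parameter give a perturbation of at most \<open>2 * c / 3\<close>, still below the lower bound
    \<open>c\<close>.\<close>
  then have "\<forall>\<^sub>F n in sequentially. (\<forall>x. norm (S n x - T x) \<le> c / 3 * norm x) \<and> dist (z n) l < c / 3"
    by (intro eventually_conj lim tendstoD[OF z(1)]) auto
  then obtain n where n: "\<And>x. norm (S n x - T x) \<le> c / 3 * norm x" "dist (z n) l < c / 3"
    by (auto simp: eventually_sequentially)
  have "norm ((S n x - z n *\<^sub>C x) - (T x - l *\<^sub>C x)) \<le> (2 * c / 3) * norm x" for x
  proof -
    have "(S n x - z n *\<^sub>C x) - (T x - l *\<^sub>C x) = (S n x - T x) - (z n - l) *\<^sub>C x"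
      by (simp add: cscale.scale_left_diff_distrib)
    also have "norm \<dots> \<le> norm (S n x - T x) + cmod (z n - l) * norm x"
      by (metis norm_triangle_ineq4 norm_scaleC)
    also have "\<dots> \<le> c / 3 * norm x + c / 3 * norm x"
      using n by (intro add_mono mult_right_mono) (auto simp: dist_norm)
    finally show ?thesis
      by simp
  qed
  from bounded_below_perturb[OF bounded_clinear_shift[OF T] bounded_clinear_shift[OF S] c s this]
  have "regular (\<lambda>x. S n x - z n *\<^sub>C x)"
    using c0 by (auto simp: regular_def)
  then show False
    using z(2)[of n] spectrum_iff_not_regular[OF S] by blast
qed

lemma compact_spectrum:
  assumes T: "bounded_clinear T"
  shows "compact (spectrum T)"
proof -
  obtain C where C: "0 < C" "\<And>x. norm (T x) \<le> C * norm x"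
    using bounded_clinear_bound[OF T] by blast
  have "bounded (spectrum T)"
    using spectrum_norm_le[OF T C(2)] C(1) by (auto simp: bounded_iff intro!: exI[of _ C])
  moreover have "closed (spectrum T)"
    unfolding closed_sequential_limits
    using spectrum_limit[OF T, of "\<lambda>_. T"] T by auto
  ultimately show ?thesis
    by (simp add: compact_eq_bounded_closed)
qed

section \<open>Orthonormal bases and finite sections\<close>

locale hilbert_basis =
  fixes e :: "nat \<Rightarrow> 'a::complex_hilbert"
  assumes basis: "orthonormal_basis e"
begin

lemma cinner_basis: "cinner (e i) (e j) = (if i = j then 1 else 0)"
  using basis by (simp add: orthonormal_basis_def)

lemma norm_basis [simp]: "norm (e i) = 1"
proof -
  have "complex_of_real ((norm (e i))\<^sup>2) = complex_of_real 1"
    using cinner_basis[of i i] unfolding cinner_self by simp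
  then have "(norm (e i))\<^sup>2 = 1"
    using of_real_eq_iff by blast
  then show ?thesis
    by (simp add: power2_eq_1_iff) (metis norm_ge_zero not_one_le_zero neg_0_le_iff_le)
qed

lemma cinner_combination:
  assumes "finite I"
  shows "cinner (\<Sum>i\<in>I. c i *\<^sub>C e i) (e j) = (if j \<in> I then c j else 0)"
proof -
  have "cinner (\<Sum>i\<in>I. c i *\<^sub>C e i) (e j) = (\<Sum>i\<in>I. if i = j then c i else 0)"
    unfolding cinner_sum_left
    by (rule sum.cong) (simp_all add: cinner_scaleC_left cinner_basis)
  then show ?thesis
    using assms by simp
qed

definition proj :: "nat \<Rightarrow> 'a \<Rightarrow> 'a" where
  "proj n x = (\<Sum>i<n. cinner x (e i) *\<^sub>C e i)"

lemma proj_symmetric: "cinner (proj n x) y = cinner x (proj n y)"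
  unfolding proj_def cinner_sum_left cinner_sum_right cinner_scaleC_left cinner_scaleC_right
  by (simp add: mult.commute flip: cinner_commute)

lemma proj_add: "proj n (x + y) = proj n x + proj n y"
  by (simp add: proj_def cinner_add_left scaleC_add_left sum.distrib)

lemma proj_scaleC: "proj n (a *\<^sub>C x) = a *\<^sub>C proj n x"
  by (simp add: proj_def cinner_scaleC_left cscale.scale_sum_right)

lemma proj_combination:
  assumes "finite I" "I \<subseteq> {..<n}"
  shows "proj n (\<Sum>i\<in>I. c i *\<^sub>C e i) = (\<Sum>i\<in>I. c i *\<^sub>C e i)"
proof -
  have "proj n (\<Sum>i\<in>I. c i *\<^sub>C e i) = (\<Sum>i<n. if i \<in> I then c i *\<^sub>C e i else 0)"
    unfolding proj_def by (rule sum.cong) (simp_all add: cinner_combination[OF assms(1)])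
  also have "\<dots> = (\<Sum>i\<in>{..<n} \<inter> I. c i *\<^sub>C e i)"
    by (rule sum.inter_restrict[symmetric]) simp
  also have "{..<n} \<inter> I = I"
    using assms(2) by blast
  finally show ?thesis .
qed

lemma proj_basis: "j < n \<Longrightarrow> proj n (e j) = e j"
  using proj_combination[of "{j}" n "\<lambda>_. 1"] by simp

lemma proj_proj: "proj n (proj n x) = proj n x"
  using proj_combination[of "{..<n}" n "\<lambda>i. cinner x (e i)"] by (simp add: proj_def)

text \<open>Cauchy-Schwarz followed by cancelling \<open>norm y\<close>. Stated abstractly since it
  serves both \<open>proj n x\<close> and the complementary \<open>x - proj n x\<close>.\<close>

lemma norm_le_of_cinner:
  assumes "complex_of_real ((norm y)\<^sup>2) = cinner y x"
  shows "norm y \<le> norm (x::'a)"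
proof (cases "y = 0")
  case False
  have "(norm y)\<^sup>2 = cmod (cinner y x)"
    by (metis assms norm_of_real abs_of_nonneg zero_le_power2)
  also have "\<dots> \<le> norm y * norm x"
    by (rule cinner_Cauchy_Schwarz)
  finally show ?thesis
    using False by (simp add: power2_eq_square)
qed simp

lemma norm_proj_le: "norm (proj n x) \<le> norm x"
  by (rule norm_le_of_cinner) (metis cinner_self proj_symmetric proj_proj)

lemma bounded_clinear_proj: "bounded_clinear (proj n)"
  by (rule bounded_clinear_intro[where C = 1]) (simp_all add: proj_add proj_scaleC norm_proj_le)

lemma norm_diff_proj_le: "norm (x - proj n x) \<le> norm x"
proof (rule norm_le_of_cinner)
  have "cinner (x - proj n x) (proj n x) = 0"
    by (metis cinner_diff_left diff_self proj_proj proj_symmetric)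
  then show "complex_of_real ((norm (x - proj n x))\<^sup>2) = cinner (x - proj n x) x"
    unfolding cinner_self[symmetric] by (simp add: cinner_diff_right)
qed

text \<open>The projections eventually fix every finite combination of basis vectors, and being
  contractions they carry the convergence over to the closure.\<close>

lemma proj_tendsto: "(\<lambda>n. proj n x) \<longlonglongrightarrow> x"
proof -
  have span: "\<exists>N. \<forall>n\<ge>N. proj n y = y" if "y \<in> cscale.span (range e)" for y
    using that
  proof (induction rule: cscale.span_induct_alt)
    case base
    show ?case
      by (simp add: bounded_clinearD(3)[OF bounded_clinear_proj])
  next
    case (step a v y)
    then obtain j N where "v = e j" "\<forall>n\<ge>N. proj n y = y"
      by blast
    then show ?case
      by (intro exI[of _ "max N (Suc j)"]) (simp add: proj_add proj_scaleC proj_basis)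
  qed
  show ?thesis
  proof (rule LIMSEQ_I)
    fix r :: real assume "0 < r"
    have "x \<in> closure (cscale.span (range e))"
      using basis by (simp add: orthonormal_basis_def)
    then obtain y where y: "y \<in> cscale.span (range e)" "dist y x < r / 2"
      using \<open>0 < r\<close> by (metis closure_approachable half_gt_zero)
    obtain N where N: "\<And>n. n \<ge> N \<Longrightarrow> proj n y = y"
      using span[OF y(1)] by blast
    have "norm (proj n x - x) < r" if "n \<ge> N" for n
    proof -
      have "proj n x - x = proj n (x - y) - (x - y)"
        using N[OF that] by (simp add: bounded_clinearD(2)[OF bounded_clinear_proj])
      then have "norm (proj n x - x) \<le> norm (proj n (x - y)) + norm (x - y)"
        by (metis norm_triangle_ineq4)
      also have "\<dots> \<le> norm (x - y) + norm (x - y)"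
        using norm_proj_le by simp
      finally show ?thesis
        using y(2) by (simp add: dist_norm norm_minus_commute)
    qed
    then show "\<exists>no. \<forall>n\<ge>no. norm (proj n x - x) < r"
      by blast
  qed
qed

text \<open>Pointwise convergence on a finite net of mesh \<open>\<epsilon> / 2\<close> suffices,
  because \<open>1 - proj n\<close> is a contraction for every \<open>n\<close>.\<close>

lemma proj_tendsto_uniformly_on_compact:
  assumes "compact K" "0 < \<epsilon>"
  shows "\<forall>\<^sub>F n in sequentially. \<forall>y\<in>K. norm (y - proj n y) \<le> \<epsilon>"
proof -
  obtain F where F: "finite F" "K \<subseteq> (\<Union>y\<in>F. ball y (\<epsilon> / 2))"
    using assms unfolding compact_eq_totally_bounded by (meson half_gt_zero)
  have "\<forall>\<^sub>F n in sequentially. \<forall>y\<in>F. dist (proj n y) y < \<epsilon> / 2"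
    using F(1) assms(2) by (intro eventually_ball_finite ballI tendstoD[OF proj_tendsto]) auto
  then show ?thesis
  proof eventually_elim
    case (elim n)
    show ?case
    proof
      fix x assume "x \<in> K"
      then obtain y where y: "y \<in> F" "norm (x - y) < \<epsilon> / 2"
        using F(2) by (force simp: dist_norm norm_minus_commute)
      have "x - proj n x = ((x - y) - proj n (x - y)) + (y - proj n y)"
        by (simp add: bounded_clinearD(2)[OF bounded_clinear_proj])
      also have "norm \<dots> \<le> norm (x - y) + norm (y - proj n y)"
        by (rule order_trans[OF norm_triangle_ineq add_right_mono[OF norm_diff_proj_le]])
      also have "\<dots> \<le> \<epsilon> / 2 + \<epsilon> / 2"
        using y elim by (intro add_mono) (auto simp: dist_norm norm_minus_commute less_imp_le)
      finally show "norm (x - proj n x) \<le> \<epsilon>"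
        by simp
    qed
  qed
qed

lemma norm_combination:
  assumes "finite I"
  shows "(norm (\<Sum>i\<in>I. c i *\<^sub>C e i))\<^sup>2 = (\<Sum>i\<in>I. (cmod (c i))\<^sup>2)"
proof -
  have "complex_of_real ((norm (\<Sum>i\<in>I. c i *\<^sub>C e i))\<^sup>2)
      = (\<Sum>j\<in>I. cnj (c j) * cinner (\<Sum>i\<in>I. c i *\<^sub>C e i) (e j))"
    by (simp only: cinner_sum_right cinner_scaleC_right cinner_self[symmetric])
  also have "\<dots> = (\<Sum>j\<in>I. complex_of_real ((cmod (c j))\<^sup>2))"
    by (rule sum.cong[OF refl]) 
      (simp only: cinner_combination[OF assms] complex_norm_square if_True mult.commute)
  finally show ?thesis
    by (metis of_real_eq_iff of_real_sum)
qed

text \<open>The coefficients \<open>f (e i)\<close> of a bounded functional are square summable, hence they define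
  the vector representing it.\<close>

lemma riesz_representation:
  fixes f :: "'a \<Rightarrow> complex"
  assumes add: "\<And>x y. f (x + y) = f x + f y" and scale: "\<And>a x. f (a *\<^sub>C x) = a * f x"
    and bound: "\<And>x. cmod (f x) \<le> C * norm x"
  shows "\<exists>v. \<forall>x. f x = cinner x v"
proof -
  have f0: "f 0 = 0"
    using scale[of 0 0] by simp
  have sum: "f (\<Sum>i\<in>I. g i) = (\<Sum>i\<in>I. f (g i))" for I :: "nat set" and g
    by (induction I rule: infinite_finite_induct) (simp_all add: add f0)
  have diff: "f (x - y) = f x - f y" for x y
    using add[of "x - y" y] by simp
  define v where "v n = (\<Sum>i<n. cnj (f (e i)) *\<^sub>C e i)" for n
  have C: "0 \<le> C"
    using order_trans[OF norm_ge_zero bound[of "e 0"]] by simp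
  have sq: "(\<Sum>i\<in>I. (cmod (f (e i)))\<^sup>2) \<le> C\<^sup>2" if "finite I" for I
  proof -
    \<comment> \<open>The extremal test vector: \<open>f u\<close> equals the square of
      \<open>norm u\<close>, so the bound of \<open>f\<close> gives
      \<open>norm u \<le> C\<close>.\<close>
    define u where "u = (\<Sum>i\<in>I. cnj (f (e i)) *\<^sub>C e i)"
    have "f u = (\<Sum>i\<in>I. complex_of_real ((cmod (f (e i)))\<^sup>2))"
      unfolding u_def sum scale complex_norm_square by (simp add: mult.commute)
    also have "\<dots> = complex_of_real ((norm u)\<^sup>2)"
      by (simp add: u_def norm_combination[OF that])
    finally have "(norm u)\<^sup>2 = cmod (f u)"
      by (metis norm_of_real abs_of_nonneg zero_le_power2)
    also have "\<dots> \<le> C * norm u"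
      by (rule bound)
    finally have "norm u \<le> C"
      using C by (cases "u = 0") (simp_all add: power2_eq_square)
    then have "(norm u)\<^sup>2 \<le> C\<^sup>2"
      by (simp add: power_mono)
    then show ?thesis
      by (simp add: u_def norm_combination[OF that])
  qed
  have "summable (\<lambda>i. (cmod (f (e i)))\<^sup>2)"
    by (rule summableI_nonneg_bounded[where x = "C\<^sup>2"]) (simp_all add: sq)
  have "Cauchy v"
  proof (rule CauchyI')
    fix r :: real assume "0 < r"
    then obtain M where M: "\<And>m n. m \<ge> M \<Longrightarrow> norm (\<Sum>i\<in>{m..<n}. (cmod (f (e i)))\<^sup>2) < r\<^sup>2"
      using \<open>summable _\<close> unfolding summable_Cauchy by (metis zero_less_power)
    have "dist (v m) (v n) < r" if "m \<ge> M" "m < n" for m n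
    proof -
      have "v n - v m = (\<Sum>i\<in>{m..<n}. cnj (f (e i)) *\<^sub>C e i)"
        using that(2) sum.atLeastLessThan_concat[of 0 m n "\<lambda>i. cnj (f (e i)) *\<^sub>C e i"]
        by (simp add: v_def lessThan_atLeast0 algebra_simps)
      then have "(norm (v n - v m))\<^sup>2 = (\<Sum>i\<in>{m..<n}. (cmod (f (e i)))\<^sup>2)"
        by (simp add: norm_combination)
      also have "\<dots> < r\<^sup>2"
        using M[OF that(1), of n] by (simp add: sum_nonneg)
      finally show ?thesis
        using \<open>0 < r\<close> by (simp add: dist_norm norm_minus_commute power2_less_imp_less)
    qed
    then show "\<exists>M. \<forall>m\<ge>M. \<forall>n>m. dist (v m) (v n) < r"
      by blast
  qed
  then obtain w where w: "v \<longlonglongrightarrow> w"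
    using Cauchy_convergent convergent_def by blast
  have "f x = cinner x w" for x
  proof -
    have "f (proj n x) = cinner x (v n)" for n
      by (simp add: proj_def v_def sum scale cinner_sum_right cinner_scaleC_right mult.commute)
    moreover have "(\<lambda>n. f (proj n x)) \<longlonglongrightarrow> f x"
    proof (rule Lim_null_comparison[THEN LIM_zero_cancel])
      show "\<forall>\<^sub>F n in sequentially. norm (f (proj n x) - f x) \<le> C * norm (proj n x - x)"
        by (rule always_eventually) (simp flip: diff add: bound)
      show "(\<lambda>n. C * norm (proj n x - x)) \<longlonglongrightarrow> 0"
        by (rule tendsto_mult_right_zero tendsto_norm_zero LIM_zero proj_tendsto)+
    qed
    moreover have "(\<lambda>n. cinner x (v n)) \<longlonglongrightarrow> cinner x w"
      by (rule bounded_linear.tendsto[OF bounded_linear_cinner_right w])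
    ultimately show ?thesis
      using LIMSEQ_unique by simp
  qed
  then show ?thesis
    by blast
qed

section \<open>Compact operators and coordinate projections\<close>

text \<open>The representing vector \<open>v\<close> plays the role of the adjoint of
  \<open>T\<close> applied to \<open>y\<close>. Symmetry moves \<open>1 - proj n\<close> from
  \<open>x\<close> onto the fixed \<open>v\<close>, which makes the estimate uniform in
  \<open>x\<close>.\<close>

lemma functional_tail_tendsto_0:
  assumes T: "bounded_clinear T" and "0 < \<epsilon>"
  shows "\<forall>\<^sub>F n in sequentially. \<forall>x. cmod (cinner (T (x - proj n x)) y) \<le> \<epsilon> * norm x"
proof -
  obtain C where C: "0 < C" "\<And>x. norm (T x) \<le> C * norm x"
    using bounded_clinear_bound[OF T] by blast
  have bound: "cmod (cinner (T x) y) \<le> (C * norm y) * norm x" for x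
    using order_trans[OF cinner_Cauchy_Schwarz mult_right_mono[OF C(2) norm_ge_zero]]
    by (metis mult.assoc mult.commute)
  obtain v where v: "\<And>x. cinner (T x) y = cinner x v"
    using riesz_representation[of "\<lambda>x. cinner (T x) y", OF _ _ bound]
    by (auto simp: bounded_clinearD[OF T] cinner_add_left cinner_scaleC_left)
  have "\<forall>\<^sub>F n in sequentially. dist (proj n v) v < \<epsilon>"
    using tendstoD[OF proj_tendsto assms(2)] .
  then show ?thesis
  proof eventually_elim
    case (elim n)
    have "cmod (cinner (T (x - proj n x)) y) \<le> \<epsilon> * norm x" for x
    proof -
      have "cinner (T (x - proj n x)) y = cinner x (v - proj n v)"
        by (simp add: v cinner_diff_left cinner_diff_right proj_symmetric)
      also have "cmod \<dots> \<le> norm x * norm (v - proj n v)"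
        by (rule cinner_Cauchy_Schwarz)
      also have "\<dots> \<le> norm x * \<epsilon>"
        using elim by (intro mult_left_mono) (auto simp: dist_norm norm_minus_commute)
      finally show ?thesis
        by (simp add: mult.commute)
    qed
    then show ?case
      by blast
  qed
qed

text \<open>The projections converge uniformly on the compact closure of the image of the unit ball;
  homogeneity extends the estimate to all \<open>x\<close>.\<close>

lemma compact_operator_proj_left:
  assumes T: "compact_operator T" and "0 < \<epsilon>"
  shows "\<forall>\<^sub>F n in sequentially. \<forall>x. norm (T x - proj n (T x)) \<le> \<epsilon> * norm x"
proof -
  have lin: "bounded_clinear T" and "compact (closure (T ` cball 0 1))"
    using T by (simp_all add: compact_operator_def)
  from proj_tendsto_uniformly_on_compact[OF this(2) assms(2)] show ?thesis
  proof eventually_elim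
    case (elim n)
    have "norm (T x - proj n (T x)) \<le> \<epsilon> * norm x" for x
    proof (cases "x = 0")
      case True
      then show ?thesis
        using bounded_clinearD(3)[OF lin] bounded_clinearD(3)[OF bounded_clinear_proj] by simp
    next
      case False
      define a where "a = complex_of_real (inverse (norm x))"
      have a: "cmod a = inverse (norm x)"
        unfolding a_def norm_of_real by simp
      then have "norm (a *\<^sub>C x) = 1"
        using False by simp
      then have "T (a *\<^sub>C x) \<in> closure (T ` cball 0 1)"
        by (intro closure_subset[THEN subsetD] imageI) simp
      then have "norm (T (a *\<^sub>C x) - proj n (T (a *\<^sub>C x))) \<le> \<epsilon>"
        using elim by blast
      moreover have "T (a *\<^sub>C x) - proj n (T (a *\<^sub>C x)) = a *\<^sub>C (T x - proj n (T x))"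
        by (simp add: bounded_clinearD(5)[OF lin] proj_scaleC cscale.scale_right_diff_distrib)
      ultimately have "cmod a * norm (T x - proj n (T x)) \<le> \<epsilon>"
        by (metis norm_scaleC)
      then show ?thesis
        using False by (simp add: a field_simps)
    qed
    then show ?case
      by blast
  qed
qed

text \<open>Compactness controls the range of \<open>T\<close>, whereas here the cut is made before
  applying \<open>T\<close>. Up to \<open>\<epsilon> / 2\<close> the operator is
  \<open>proj m\<close> after \<open>T\<close>, that is, \<open>m\<close> functionals with
  \<open>m\<close> fixed before \<open>n\<close>, and each of them has small tails.\<close>

lemma compact_operator_proj_right:
  assumes T: "compact_operator T" and "0 < \<epsilon>"
  shows "\<forall>\<^sub>F n in sequentially. \<forall>x. norm (T (x - proj n x)) \<le> \<epsilon> * norm x"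
proof -
  have lin: "bounded_clinear T"
    using T by (simp add: compact_operator_def)
  obtain m where m: "\<And>x. norm (T x - proj m (T x)) \<le> \<epsilon> / 2 * norm x"
    using compact_operator_proj_left[OF T, of "\<epsilon> / 2"] assms(2)
    by (auto simp: eventually_sequentially)
  \<comment> \<open>The \<open>m\<close> coordinates contribute at most
    \<open>m * \<eta> \<le> \<epsilon> / 2\<close>; the added 1 keeps the quotient meaningful for
    \<open>m = 0\<close>.\<close>
  define \<eta> where "\<eta> = \<epsilon> / 2 / (m + 1)"
  have "\<forall>\<^sub>F n in sequentially. \<forall>i\<in>{..<m}. \<forall>x. cmod (cinner (T (x - proj n x)) (e i)) \<le> \<eta> * norm x"
    using assms(2) unfolding \<eta>_def
    by (intro eventually_ball_finite ballI functional_tail_tendsto_0[OF lin]) auto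
  then show ?thesis
  proof eventually_elim
    case (elim n)
    have "norm (T (x - proj n x)) \<le> \<epsilon> * norm x" for x
    proof -
      let ?y = "T (x - proj n x)"
      have "norm (proj m ?y) \<le> (\<Sum>i<m. cmod (cinner ?y (e i)))"
        unfolding proj_def by (rule order_trans[OF norm_sum]) simp
      also have "\<dots> \<le> (\<Sum>i<m. \<eta> * norm x)"
        using elim by (intro sum_mono) simp
      also have "\<dots> = (m * \<eta>) * norm x"
        by simp
      also have "\<dots> \<le> \<epsilon> / 2 * norm x"
        using assms(2) by (intro mult_right_mono) (auto simp: \<eta>_def field_simps)
      finally have "norm (proj m ?y) \<le> \<epsilon> / 2 * norm x" .
      moreover have "norm (?y - proj m ?y) \<le> \<epsilon> / 2 * norm x"
        using assms(2) by (intro order_trans[OF m mult_left_mono[OF norm_diff_proj_le]]) simp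
      ultimately show ?thesis
        using norm_triangle_ineq[of "?y - proj m ?y" "proj m ?y"] by simp
    qed
    then show ?case
      by blast
  qed
qed

section \<open>Finite sections\<close>

text \<open>Acts on the whole space, by zero beyond the first \<open>n\<close> basis vectors, so
  that sections can be compared with \<open>T\<close> in operator norm. The matrix need not come
  from any operator, which allows rounded entries.\<close>

definition finite_section :: "nat \<Rightarrow> inf_matrix \<Rightarrow> 'a \<Rightarrow> 'a" where
  "finite_section n M x = (\<Sum>i<n. (\<Sum>j<n. M i j * cinner x (e j)) *\<^sub>C e i)"

lemma finite_section_diff:
  "finite_section n M x - finite_section n M' x = finite_section n (\<lambda>i j. M i j - M' i j) x"
  by (simp add: finite_section_def left_diff_distrib sum_subtractf cscale.scale_left_diff_distrib)

text \<open>A crude entrywise estimate; its factor \<open>n^2\<close> dictates the cubic resolution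
  of the rounding grid.\<close>

lemma norm_finite_section_le:
  assumes "\<And>i j. i < n \<Longrightarrow> j < n \<Longrightarrow> cmod (M i j) \<le> h"
  shows "norm (finite_section n M x) \<le> (real n)\<^sup>2 * h * norm x"
proof -
  have "norm (finite_section n M x) \<le> (\<Sum>i<n. \<Sum>j<n. cmod (M i j) * cmod (cinner x (e j)))"
    unfolding finite_section_def
    by (rule order_trans[OF norm_sum]) (auto intro!: sum_mono norm_sum[THEN order_trans] simp: norm_mult)
  also have "\<dots> \<le> (\<Sum>i<n. \<Sum>j<n. h * norm x)"
  proof (intro sum_mono mult_mono)
    fix i j assume "i \<in> {..<n}" "j \<in> {..<n}"
    then show "cmod (M i j) \<le> h"
      using assms by simp
    then show "0 \<le> h"
      using norm_ge_zero order_trans by blast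
    show "cmod (cinner x (e j)) \<le> norm x"
      using cinner_Cauchy_Schwarz[of x "e j"] by simp
  qed simp
  finally show ?thesis
    by (simp add: power2_eq_square)
qed

lemma bounded_clinear_finite_section: "bounded_clinear (finite_section n M)"
proof (rule bounded_clinear_intro)
  show "norm (finite_section n M x) \<le> (real n)\<^sup>2 * (\<Sum>i<n. \<Sum>j<n. cmod (M i j)) * norm x" for x
  proof (rule norm_finite_section_le)
    fix i j assume "i < n" "j < n"
    then have "cmod (M i j) \<le> (\<Sum>j<n. cmod (M i j))"
      by (intro member_le_sum) auto
    also have "\<dots> \<le> (\<Sum>i<n. \<Sum>j<n. cmod (M i j))"
      using \<open>i < n\<close> by (intro member_le_sum) (auto simp: sum_nonneg)
    finally show "cmod (M i j) \<le> (\<Sum>i<n. \<Sum>j<n. cmod (M i j))" .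
  qed
qed (simp_all add: finite_section_def cinner_add_left cinner_scaleC_left distrib_left sum.distrib
      scaleC_add_left cscale.scale_sum_right mult.left_commute flip: sum_distrib_left)

lemma finite_section_matrix_of:
  assumes "bounded_clinear T"
  shows "finite_section n (matrix_of e T) x = proj n (T (proj n x))"
proof -
  have "cinner (T (proj n x)) (e i) = (\<Sum>j<n. matrix_of e T i j * cinner x (e j))" for i
    by (simp add: proj_def matrix_of_def bounded_clinearD[OF assms] cinner_sum_left
        cinner_scaleC_left mult.commute)
  then show ?thesis
    by (simp add: finite_section_def proj_def[of n "T _"])
qed

text \<open>With \<open>P\<close> for \<open>proj n\<close>, the error \<open>P T P - T\<close>
  equals \<open>- P T (1 - P) - (1 - P) T\<close>, so both one-sided approximations are
  used.\<close>

lemma finite_section_tendsto: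
  assumes T: "compact_operator T" and "0 < \<epsilon>"
  shows "\<forall>\<^sub>F n in sequentially. \<forall>x. norm (finite_section n (matrix_of e T) x - T x) \<le> \<epsilon> * norm x"
proof -
  have lin: "bounded_clinear T"
    using T by (simp add: compact_operator_def)
  have "\<epsilon> / 2 > 0"
    using assms(2) by simp
  from compact_operator_proj_left[OF T this] compact_operator_proj_right[OF T this]
  show ?thesis
  proof eventually_elim
    case (elim n)
    have "norm (finite_section n (matrix_of e T) x - T x) \<le> \<epsilon> * norm x" for x
    proof -
      have "finite_section n (matrix_of e T) x - T x
          = - proj n (T (x - proj n x)) - (T x - proj n (T x))"
        by (simp add: finite_section_matrix_of[OF lin] bounded_clinearD(2)[OF lin]
            bounded_clinearD(2)[OF bounded_clinear_proj])
      also have "norm \<dots> \<le> norm (proj n (T (x - proj n x))) + norm (T x - proj n (T x))"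
        by (metis norm_minus_cancel norm_triangle_ineq4)
      also have "\<dots> \<le> \<epsilon> / 2 * norm x + \<epsilon> / 2 * norm x"
        using elim by (intro add_mono order_trans[OF norm_proj_le]) auto
      finally show ?thesis
        by simp
    qed
    then show ?case
      by blast
  qed
qed

text \<open>The vector \<open>e n\<close>, the first one beyond the section, lies in the kernel.
  This settles lower semicontinuity at 0, where passing to reciprocals is impossible.\<close>

lemma zero_in_spectrum_finite_section: "0 \<in> spectrum (finite_section n M)"
proof (rule ccontr)
  assume "0 \<notin> spectrum (finite_section n M)"
  then obtain c where "bounded_below c (\<lambda>x. finite_section n M x - 0 *\<^sub>C x)"
    by (auto simp: spectrum_iff_not_regular[OF bounded_clinear_finite_section] regular_def)
  moreover have "finite_section n M (e n) = 0"
    by (simp add: finite_section_def cinner_basis)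
  ultimately have "c * norm (e n) \<le> 0" "0 < c"
    unfolding bounded_below_def by (metis cscale.scale_zero_left diff_zero norm_zero, simp)
  then show False
    by simp
qed

end

section \<open>Determinants\<close>

text \<open>This and the next lemma turn matrix facts into finite sums over index functions, the
  form in which the operator argument meets them.\<close>

lemma det_zero_kernel:
  fixes M :: "nat \<Rightarrow> nat \<Rightarrow> complex"
  assumes "Determinant.det (Matrix.mat m m (\<lambda>(i, j). M i j)) = 0"
  obtains c where "\<exists>i<m. c i \<noteq> 0" "\<And>i. i < m \<Longrightarrow> (\<Sum>j<m. M i j * c j) = 0"
proof -
  define X where "X = Matrix.mat m m (\<lambda>(i, j). M i j)"
  have X: "X \<in> carrier_mat m m"
    by (simp add: X_def)
  obtain v where v: "v \<in> carrier_vec m" "v \<noteq> 0\<^sub>v m" "X *\<^sub>v v = 0\<^sub>v m"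
    using det_0_iff_vec_prod_zero_field[OF X] assms by (auto simp: X_def)
  show ?thesis
  proof (rule that)
    show "\<exists>i<m. v $ i \<noteq> 0"
      using v(1,2) by (metis carrier_vecD eq_vecI index_zero_vec)
    show "(\<Sum>j<m. M i j * v $ j) = 0" if "i < m" for i
    proof -
      have "(X *\<^sub>v v) $ i = (\<Sum>j<m. M i j * v $ j)"
        using that v(1) by (simp add: X_def scalar_prod_def lessThan_atLeast0)
      then show ?thesis
        using v(3) that by simp
    qed
  qed
qed

lemma det_nonzero_inverse:
  fixes M :: "nat \<Rightarrow> nat \<Rightarrow> complex"
  assumes "Determinant.det (Matrix.mat m m (\<lambda>(i, j). M i j)) \<noteq> 0"
  obtains L where
    "\<And>i j. i < m \<Longrightarrow> j < m \<Longrightarrow> (\<Sum>k<m. L i k * M k j) = (if i = j then 1 else 0)"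
    "\<And>i j. i < m \<Longrightarrow> j < m \<Longrightarrow> (\<Sum>k<m. M i k * L k j) = (if i = j then 1 else 0)"
proof -
  define X where "X = Matrix.mat m m (\<lambda>(i, j). M i j)"
  have X: "X \<in> carrier_mat m m"
    by (simp add: X_def)
  have "X \<in> Units (ring_mat TYPE(complex) m ())"
    using det_non_zero_imp_unit[OF X] assms by (simp add: X_def)
  then obtain Y where Y: "Y \<in> carrier_mat m m" "Y * X = 1\<^sub>m m" "X * Y = 1\<^sub>m m"
    by (auto simp: Units_def ring_mat_def)
  show ?thesis
  proof (rule that)
    fix i j assume ij: "i < m" "j < m"
    have "(Y * X) $$ (i, j) = (\<Sum>k<m. Y $$ (i, k) * M k j)"
      using ij Y(1) by (simp add: X_def scalar_prod_def lessThan_atLeast0)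
    then show "(\<Sum>k<m. Y $$ (i, k) * M k j) = (if i = j then 1 else 0)"
      using ij Y(2) by simp
    have "(X * Y) $$ (i, j) = (\<Sum>k<m. M i k * Y $$ (k, j))"
      using ij Y(1) by (simp add: X_def scalar_prod_def lessThan_atLeast0)
    then show "(\<Sum>k<m. M i k * Y $$ (k, j)) = (if i = j then 1 else 0)"
      using ij Y(3) by simp
  qed
qed

text \<open>In the Leibniz form the determinant is a polynomial in the entries, so holomorphy and
  uniform convergence can be checked entry by entry.\<close>

lemma det_mat_eq:
  "Determinant.det (Matrix.mat m m (\<lambda>(i, j). M i j)) =
     (\<Sum>p | p permutes {0..<m}. signof p * (\<Prod>i = 0..<m. M i (p i)))"
  unfolding det_def'[OF mat_carrier]
proof (rule sum.cong[OF refl])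
  fix p assume "p \<in> {p. p permutes {0..<m}}"
  then have "p i < m" if "i < m" for i
    using that permutes_in_image[of p "{0..<m}" i] by simp
  then show "signof p * (\<Prod>i = 0..<m. Matrix.mat m m (\<lambda>(i, j). M i j) $$ (i, p i))
      = signof p * (\<Prod>i = 0..<m. M i (p i))"
    by (intro arg_cong[where f = "(*) (signof p)"] prod.cong) auto
qed

lemma holomorphic_on_det:
  assumes "\<And>i j. i < m \<Longrightarrow> j < m \<Longrightarrow> (\<lambda>w. M w i j) holomorphic_on X"
  shows "(\<lambda>w. Determinant.det (Matrix.mat m m (\<lambda>(i, j). M w i j))) holomorphic_on X"
  unfolding det_mat_eq
proof (intro holomorphic_intros)
  fix p i assume "p \<in> {p. p permutes {0..<m}}" "i \<in> {0..<m}"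
  then show "(\<lambda>w. M w i (p i)) holomorphic_on X"
    using permutes_in_image[of p "{0..<m}" i] by (intro assms) auto
qed

text \<open>Boundedness is part of the conclusion because the induction multiplies two uniform
  limits, which requires both limit functions to be bounded.\<close>

lemma uniform_limit_prod:
  fixes f :: "'i \<Rightarrow> 'b \<Rightarrow> 'c \<Rightarrow> 'd::{real_normed_field}"
  assumes "finite I" "\<And>i. i \<in> I \<Longrightarrow> uniform_limit X (f i) (g i) F"
    "\<And>i. i \<in> I \<Longrightarrow> bounded (g i ` X)"
  shows "uniform_limit X (\<lambda>n x. \<Prod>i\<in>I. f i n x) (\<lambda>x. \<Prod>i\<in>I. g i x) F
    \<and> bounded ((\<lambda>x. \<Prod>i\<in>I. g i x) ` X)"
  using assms
proof (induction I)
  case empty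
  have "bounded ((\<lambda>x. 1) ` X :: 'd set)"
    by (rule bounded_subset[of "{1}"]) auto
  then show ?case
    by (simp add: uniform_limit_const)
next
  case (insert j I)
  then have IH: "uniform_limit X (\<lambda>n x. \<Prod>i\<in>I. f i n x) (\<lambda>x. \<Prod>i\<in>I. g i x) F"
    "bounded ((\<lambda>x. \<Prod>i\<in>I. g i x) ` X)"
    and j: "uniform_limit X (f j) (g j) F" "bounded (g j ` X)"
    by auto
  obtain a where a: "\<And>x. x \<in> X \<Longrightarrow> norm (g j x) \<le> a"
    using j(2) by (auto simp: bounded_iff)
  obtain b where b: "\<And>x. x \<in> X \<Longrightarrow> norm (\<Prod>i\<in>I. g i x) \<le> b"
    using IH(2) by (auto simp: bounded_iff)
  have "norm (g j x * (\<Prod>i\<in>I. g i x)) \<le> a * b" if "x \<in> X" for x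
    unfolding norm_mult using a[OF that] b[OF that] order_trans[OF norm_ge_zero]
    by (intro mult_mono) blast+
  then have "bounded ((\<lambda>x. g j x * (\<Prod>i\<in>I. g i x)) ` X)"
    by (auto simp: bounded_iff)
  then show ?case
    using uniform_lim_mult[OF j(1) IH(1) j(2) IH(2)] insert.hyps by simp
qed

lemma uniform_limit_sum:
  fixes f :: "'i \<Rightarrow> 'b \<Rightarrow> 'c \<Rightarrow> 'd::real_normed_vector"
  assumes "\<And>i. i \<in> I \<Longrightarrow> uniform_limit X (f i) (g i) F"
  shows "uniform_limit X (\<lambda>n x. \<Sum>i\<in>I. f i n x) (\<lambda>x. \<Sum>i\<in>I. g i x) F"
  using assms
  by (induction I rule: infinite_finite_induct) (simp_all add: uniform_limit_const uniform_limit_add)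

lemma uniform_limit_det:
  fixes M :: "'n \<Rightarrow> 'x \<Rightarrow> nat \<Rightarrow> nat \<Rightarrow> complex"
  assumes lim: "\<And>i j. i < m \<Longrightarrow> j < m \<Longrightarrow> uniform_limit X (\<lambda>n w. M n w i j) (\<lambda>w. L w i j) F"
    and bd: "\<And>i j. i < m \<Longrightarrow> j < m \<Longrightarrow> bounded ((\<lambda>w. L w i j) ` X)"
  shows "uniform_limit X (\<lambda>n w. Determinant.det (Matrix.mat m m (\<lambda>(i, j). M n w i j)))
    (\<lambda>w. Determinant.det (Matrix.mat m m (\<lambda>(i, j). L w i j))) F"
  unfolding det_mat_eq
proof (rule uniform_limit_sum)
  fix p assume "p \<in> {p. p permutes {0..<m}}"
  then have "p i < m" if "i < m" for i
    using that permutes_in_image[of p "{0..<m}" i] by simp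
  then have "uniform_limit X (\<lambda>n w. \<Prod>i = 0..<m. M n w i (p i)) (\<lambda>w. \<Prod>i = 0..<m. L w i (p i)) F"
    by (intro uniform_limit_prod[THEN conjunct1] lim bd) auto
  then show "uniform_limit X (\<lambda>n w. signof p * (\<Prod>i = 0..<m. M n w i (p i)))
      (\<lambda>w. signof p * (\<Prod>i = 0..<m. L w i (p i))) F"
    by (rule bounded_linear.uniform_limit[OF bounded_linear_mult_right])
qed

section \<open>Continuity of the spectrum\<close>

context hilbert_basis
begin

section \<open>Reduction of invertibility to a finite determinant\<close>

definition tail_op :: "nat \<Rightarrow> ('a \<Rightarrow> 'a) \<Rightarrow> 'a \<Rightarrow> 'a" where
  "tail_op m A x = A (x - proj m x)"

text \<open>The operator \<open>(1 - w K)\<^sup>-\<^sup>1\<close> for the tail \<open>K\<close>; it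
  has this meaning only where \<open>cmod w * \<delta> < 1\<close> for a bound
  \<open>\<delta>\<close> of the tail.\<close>

definition tail_solve :: "nat \<Rightarrow> ('a \<Rightarrow> 'a) \<Rightarrow> complex \<Rightarrow> 'a \<Rightarrow> 'a" where
  "tail_solve m A w = inverse_op (\<lambda>x. x - w *\<^sub>C tail_op m A x)"

text \<open>Writing \<open>A = K + A P\<close> with \<open>P\<close> the projection onto the first \<open>m\<close> basis vectors, the
  equation \<open>x - w A x = y\<close> reads \<open>x = (1 - w K)\<^sup>-\<^sup>1 (y + w A P x)\<close>, which is a linear system
  for the first \<open>m\<close> coordinates of \<open>x\<close>. The following is its matrix.\<close>

definition red_matrix :: "nat \<Rightarrow> ('a \<Rightarrow> 'a) \<Rightarrow> complex \<Rightarrow> nat \<Rightarrow> nat \<Rightarrow> complex" where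
  "red_matrix m A w i j = (if i = j then 1 else 0) - w * cinner (tail_solve m A w (A (e j))) (e i)"

text \<open>The factorization
  \<open>1 - w A = (1 - w K) (1 - w (1 - w K)\<^sup>-\<^sup>1 A P)\<close> has an invertible first
  factor, and the second one differs from the identity by finite rank. This is the determinant of
  its compression to the first \<open>m\<close> coordinates.\<close>

definition red_det :: "nat \<Rightarrow> ('a \<Rightarrow> 'a) \<Rightarrow> complex \<Rightarrow> complex" where
  "red_det m A w = Determinant.det (Matrix.mat m m (\<lambda>(i, j). red_matrix m A w i j))"

lemma red_det_0: "red_det m A 0 = 1"
proof -
  have "Matrix.mat m m (\<lambda>(i, j). red_matrix m A 0 i j) = 1\<^sub>m m"
    by (rule eq_matI) (simp_all add: red_matrix_def)
  then show ?thesis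
    by (simp add: red_det_def)
qed

context
  fixes A :: "'a \<Rightarrow> 'a" and m :: nat and \<delta> :: real
  assumes A: "bounded_clinear A"
    and \<delta>: "\<And>x. norm (A (x - proj m x)) \<le> \<delta> * norm x" "0 \<le> \<delta>"
begin

lemma norm_tail_op_le: "norm (tail_op m A x) \<le> \<delta> * norm x"
  by (simp add: tail_op_def \<delta>)

lemma bounded_clinear_tail_op: "bounded_clinear (tail_op m A)"
  by (rule bounded_clinear_intro[OF _ _ norm_tail_op_le])
    (simp_all add: tail_op_def proj_add proj_scaleC bounded_clinearD[OF A] add_diff_add
      cscale.scale_right_diff_distrib)

lemma tail_solve_unique:
  assumes w: "cmod w * \<delta> < 1" and x: "x - w *\<^sub>C tail_op m A x = u"
  shows "x = tail_solve m A w u"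
  using bounded_below_inj[OF bounded_clinear_id_minus[OF bounded_clinear_tail_op]
      bounded_below_id_minus(1)[OF bounded_clinear_tail_op norm_tail_op_le \<delta>(2) w]]
  unfolding tail_solve_def using x inv_into_f_f by fastforce

lemma tail_solve_eq:
  assumes w: "cmod w * \<delta> < 1"
  shows "tail_solve m A w u - w *\<^sub>C tail_op m A (tail_solve m A w u) = u"
  unfolding tail_solve_def
  by (rule surj_f_inv_f[OF bounded_below_id_minus(2)[OF bounded_clinear_tail_op norm_tail_op_le \<delta>(2) w]])

lemma tail_bounded_below:
  assumes w: "cmod w * \<delta> < 1"
  shows "(1 - cmod w * \<delta>) * norm x \<le> norm (x - w *\<^sub>C tail_op m A x)"
  using bounded_below_id_minus(1)[OF bounded_clinear_tail_op norm_tail_op_le \<delta>(2) w]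
  by (simp add: bounded_below_def)

lemma norm_tail_solve_le:
  assumes w: "cmod w * \<delta> < 1"
  shows "norm (tail_solve m A w u) \<le> norm u / (1 - cmod w * \<delta>)"
  using tail_bounded_below[OF w, of "tail_solve m A w u"] w
  by (simp add: tail_solve_eq[OF w] field_simps)

lemma tail_decomposition: "A x = tail_op m A x + (\<Sum>j<m. cinner x (e j) *\<^sub>C A (e j))"
proof -
  have "A (proj m x) = (\<Sum>j<m. cinner x (e j) *\<^sub>C A (e j))"
    by (simp add: proj_def bounded_clinearD[OF A])
  then show ?thesis
    by (simp add: tail_op_def bounded_clinearD[OF A])
qed

text \<open>The right-hand side of \<open>x = (1 - w K)\<^sup>-\<^sup>1 (y + w A P x)\<close> with
  the unknown coordinates of \<open>x\<close> replaced by a guess \<open>c\<close>.\<close>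

definition assemble :: "complex \<Rightarrow> 'a \<Rightarrow> (nat \<Rightarrow> complex) \<Rightarrow> 'a" where
  "assemble w y c = tail_solve m A w y + (\<Sum>j<m. (w * c j) *\<^sub>C tail_solve m A w (A (e j)))"

lemma assemble_eq:
  assumes w: "cmod w * \<delta> < 1"
  shows "assemble w y c - w *\<^sub>C tail_op m A (assemble w y c) = y + w *\<^sub>C (\<Sum>j<m. c j *\<^sub>C A (e j))"
proof -
  let ?G = "\<lambda>x. x - w *\<^sub>C tail_op m A x"
  have "bounded_clinear ?G"
    by (rule bounded_clinear_id_minus[OF bounded_clinear_tail_op])
  note G = bounded_clinearD[OF this]
  have "?G (assemble w y c) = ?G (tail_solve m A w y)
      + (\<Sum>j<m. (w * c j) *\<^sub>C ?G (tail_solve m A w (A (e j))))"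
    unfolding assemble_def G(1) G(6) G(5) ..
  then show ?thesis
    by (simp add: tail_solve_eq[OF w] cscale.scale_sum_right)
qed

text \<open>The defect between the actual and the guessed coordinates is the residual of the linear
  system. Both directions of the correspondence rest on this identity.\<close>

lemma red_matrix_assemble:
  assumes "i < m"
  shows "cinner (assemble w y c) (e i) - c i
    = cinner (tail_solve m A w y) (e i) - (\<Sum>j<m. red_matrix m A w i j * c j)"
proof -
  have "(\<Sum>j<m. red_matrix m A w i j * c j)
      = (\<Sum>j<m. if i = j then c j else 0) - (\<Sum>j<m. w * c j * cinner (tail_solve m A w (A (e j))) (e i))"
    unfolding sum_subtractf[symmetric]
    by (rule sum.cong) (simp_all add: red_matrix_def algebra_simps)
  then show ?thesis
    using assms by (simp add: assemble_def cinner_add_left cinner_sum_left cinner_scaleC_left)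
qed

text \<open>A solution of the system reproduces its own coordinates, so the sum of the
  \<open>c j *\<^sub>C A (e j)\<close> becomes \<open>A P\<close> applied to the assembled vector
  and completes the tail to \<open>A\<close>.\<close>

lemma assemble_solution:
  assumes w: "cmod w * \<delta> < 1"
    and c: "\<And>i. i < m \<Longrightarrow> (\<Sum>j<m. red_matrix m A w i j * c j) = cinner (tail_solve m A w y) (e i)"
  shows "assemble w y c - w *\<^sub>C A (assemble w y c) = y"
    and "i < m \<Longrightarrow> cinner (assemble w y c) (e i) = c i"
proof -
  show *: "cinner (assemble w y c) (e i) = c i" if "i < m" for i
    using red_matrix_assemble[OF that, of w y c] c[OF that] by simp
  have "w *\<^sub>C A (assemble w y c) = w *\<^sub>C tail_op m A (assemble w y c) + w *\<^sub>C (\<Sum>j<m. c j *\<^sub>C A (e j))"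
    unfolding tail_decomposition[of "assemble w y c"] scaleC_add_right by (simp add: *)
  then show "assemble w y c - w *\<^sub>C A (assemble w y c) = y"
    using assemble_eq[OF w, of y c] by (simp add: algebra_simps)
qed

text \<open>Given \<open>y\<close>, a solution is determined by its first \<open>m\<close>
  coordinates; a bound on these therefore bounds the solution.\<close>

lemma solution_assemble:
  assumes w: "cmod w * \<delta> < 1" and x: "x - w *\<^sub>C A x = y"
  shows "x = assemble w y (\<lambda>j. cinner x (e j))"
proof -
  have "x - w *\<^sub>C tail_op m A x = y + w *\<^sub>C (\<Sum>j<m. cinner x (e j) *\<^sub>C A (e j))"
    using x unfolding tail_decomposition[of x] scaleC_add_right by (simp add: algebra_simps)
  then show ?thesis
    using tail_solve_unique[OF w] assemble_eq[OF w] by metis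
qed

text \<open>A kernel vector of the matrix assembles to a kernel vector of \<open>1 - w A\<close>,
  nonzero since it keeps its coordinates. Conversely, the right inverse of the matrix solves the
  equation and the left inverse bounds the coordinates of every solution.\<close>

lemma regular_iff_red_det:
  assumes w: "cmod w * \<delta> < 1"
  shows "regular (\<lambda>x. x - w *\<^sub>C A x) \<longleftrightarrow> red_det m A w \<noteq> 0"
proof
  assume reg: "regular (\<lambda>x. x - w *\<^sub>C A x)"
  show "red_det m A w \<noteq> 0"
  proof
    assume "red_det m A w = 0"
    then obtain c where c: "\<exists>i<m. c i \<noteq> 0" "\<And>i. i < m \<Longrightarrow> (\<Sum>j<m. red_matrix m A w i j * c j) = 0"
      unfolding red_det_def by (rule det_zero_kernel) blast
    have "tail_solve m A w 0 = 0"
      using tail_solve_unique[OF w, of 0 0] bounded_clinearD(3)[OF bounded_clinear_tail_op] by simp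
    then have c': "(\<Sum>j<m. red_matrix m A w i j * c j) = cinner (tail_solve m A w 0) (e i)" if "i < m" for i
      using c(2)[OF that] by simp
    obtain b where b: "0 < b" "\<And>x. b * norm x \<le> norm (x - w *\<^sub>C A x)"
      using reg by (auto simp: regular_def bounded_below_def)
    \<comment> \<open>The lower bound forces this vector to vanish, although its first
      \<open>m\<close> coordinates are the \<open>c i\<close>, which are not all zero.\<close>
    have "assemble w 0 c = 0"
      using b(1) b(2)[of "assemble w 0 c"] assemble_solution(1)[OF w c'] by (simp add: mult_le_0_iff)
    then show False
      using assemble_solution(2)[OF w c'] c(1) by auto
  qed
next
  assume "red_det m A w \<noteq> 0"
  then obtain L where
    L: "\<And>i j. i < m \<Longrightarrow> j < m \<Longrightarrow> (\<Sum>k<m. L i k * red_matrix m A w k j) = (if i = j then 1 else 0)"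
      "\<And>i j. i < m \<Longrightarrow> j < m \<Longrightarrow> (\<Sum>k<m. red_matrix m A w i k * L k j) = (if i = j then 1 else 0)"
    unfolding red_det_def by (rule det_nonzero_inverse) blast
  define q where "q = 1 - cmod w * \<delta>"
  have q: "0 < q"
    using w by (simp add: q_def)
  define b where "b y i = cinner (tail_solve m A w y) (e i)" for y i
  have b: "cmod (b y i) \<le> norm y / q" for y i
    using order_trans[OF cinner_Cauchy_Schwarz, of "tail_solve m A w y" "e i"] norm_tail_solve_le[OF w]
    by (simp add: b_def q_def)
  have "surj (\<lambda>x. x - w *\<^sub>C A x)"
  proof (rule surjI)
    fix y
    show "assemble w y (\<lambda>j. \<Sum>k<m. L j k * b y k) - w *\<^sub>C A (assemble w y (\<lambda>j. \<Sum>k<m. L j k * b y k)) = y"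
    proof (rule assemble_solution(1)[OF w])
      fix i assume "i < m"
      have "(\<Sum>j<m. red_matrix m A w i j * (\<Sum>k<m. L j k * b y k))
          = (\<Sum>k<m. (\<Sum>j<m. red_matrix m A w i j * L j k) * b y k)"
        unfolding sum_distrib_left sum_distrib_right by (subst sum.swap) (simp add: mult.assoc)
      also have "\<dots> = (\<Sum>k<m. if i = k then b y k else 0)"
        using \<open>i < m\<close> by (intro sum.cong) (simp_all add: L(2))
      finally show "(\<Sum>j<m. red_matrix m A w i j * (\<Sum>k<m. L j k * b y k)) = cinner (tail_solve m A w y) (e i)"
        using \<open>i < m\<close> by (simp add: b_def)
    qed
  qed
  moreover have "\<exists>c. bounded_below c (\<lambda>x. x - w *\<^sub>C A x)"
  proof -
    \<comment> \<open>Obtained by inserting the coordinate bound for \<open>c j\<close> and the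
      bound \<open>1 / q\<close> of \<open>tail_solve\<close> into the definition of
      \<open>assemble\<close>.\<close>
    define C where "C = 1 / q + (\<Sum>j<m. cmod w * (\<Sum>k<m. cmod (L j k) / q) * (norm (A (e j)) / q))"
    have C: "0 < C"
      unfolding C_def using q by (intro add_pos_nonneg sum_nonneg mult_nonneg_nonneg) (auto simp: divide_nonneg_pos)
    have "norm x \<le> C * norm (x - w *\<^sub>C A x)" for x
    proof -
      define y where "y = x - w *\<^sub>C A x"
      define c where "c j = cinner x (e j)" for j
      have x: "x = assemble w y c"
        unfolding c_def by (rule solution_assemble[OF w]) (simp add: y_def)
      \<comment> \<open>Here the guess consists of the true coordinates, so the defect is zero and
        the system holds exactly.\<close>
      have Nc: "(\<Sum>j<m. red_matrix m A w i j * c j) = b y i" if "i < m" for i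
        using red_matrix_assemble[OF that, of w y c] x by (simp add: c_def b_def)
      have c: "cmod (c i) \<le> (\<Sum>k<m. cmod (L i k) / q) * norm y" if "i < m" for i
      proof -
        have "(\<Sum>k<m. L i k * b y k) = (\<Sum>k<m. L i k * (\<Sum>j<m. red_matrix m A w k j * c j))"
          by (intro sum.cong) (simp_all add: Nc)
        also have "\<dots> = (\<Sum>j<m. (\<Sum>k<m. L i k * red_matrix m A w k j) * c j)"
          unfolding sum_distrib_left sum_distrib_right by (subst sum.swap) (simp add: mult.assoc)
        also have "\<dots> = (\<Sum>j<m. if i = j then c j else 0)"
          using that by (intro sum.cong) (simp_all add: L(1))
        also have "\<dots> = c i"
          using that by simp
        finally have "cmod (c i) \<le> (\<Sum>k<m. cmod (L i k) * cmod (b y k))"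
          by (metis (no_types, lifting) norm_mult norm_sum sum.cong)
        also have "\<dots> \<le> (\<Sum>k<m. cmod (L i k) * (norm y / q))"
          by (intro sum_mono mult_left_mono b) simp
        finally show ?thesis
          by (simp add: sum_distrib_right)
      qed
      have "norm x \<le> norm (tail_solve m A w y)
          + (\<Sum>j<m. cmod w * cmod (c j) * norm (tail_solve m A w (A (e j))))"
        unfolding x assemble_def
        by (rule order_trans[OF norm_triangle_ineq add_left_mono], rule order_trans[OF norm_sum])
          (simp add: norm_mult)
      also have "\<dots> \<le> norm y / q
          + (\<Sum>j<m. cmod w * ((\<Sum>k<m. cmod (L j k) / q) * norm y) * (norm (A (e j)) / q))"
        using norm_tail_solve_le[OF w] q unfolding q_def[symmetric]
        by (intro add_mono sum_mono mult_mono mult_left_mono c)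
          (auto intro!: mult_nonneg_nonneg sum_nonneg divide_nonneg_pos)
      also have "\<dots> = C * norm y"
        unfolding C_def distrib_right by (subst sum_distrib_right) (simp add: mult_ac)
      finally show ?thesis
        by (simp add: y_def)
    qed
    then have "bounded_below (1 / C) (\<lambda>x. x - w *\<^sub>C A x)"
      using C by (simp add: bounded_below_def field_simps)
    then show ?thesis ..
  qed
  ultimately show "regular (\<lambda>x. x - w *\<^sub>C A x)"
    by (simp add: regular_def)
qed

section \<open>Dependence of the determinant on \<open>w\<close> and on the operator\<close>

text \<open>The Neumann series. Applying \<open>1 - w K\<close> to a partial sum telescopes, and the
  lower bound of \<open>1 - w K\<close> turns the remainder into a geometric error. Pairing with
  \<open>v\<close> gives a scalar power series in \<open>w\<close>, hence holomorphy.\<close>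

lemma tail_solve_sums:
  assumes w: "cmod w * \<delta> < 1"
  shows "(\<lambda>k. cinner ((tail_op m A ^^ k) u) v * w ^ k) sums cinner (tail_solve m A w u) v"
proof -
  let ?K = "tail_op m A"
  note K = bounded_clinearD[OF bounded_clinear_tail_op]
  define s where "s N = (\<Sum>k<N. w ^ k *\<^sub>C (?K ^^ k) u)" for N
  have s: "s N - w *\<^sub>C ?K (s N) = u - w ^ N *\<^sub>C (?K ^^ N) u" for N
  proof (induction N)
    case 0
    show ?case
      by (simp add: s_def K)
  next
    case (Suc N)
    have "s (Suc N) - w *\<^sub>C ?K (s (Suc N))
        = (s N - w *\<^sub>C ?K (s N)) + w ^ N *\<^sub>C (?K ^^ N) u - w *\<^sub>C ?K (w ^ N *\<^sub>C (?K ^^ N) u)"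
      by (simp add: s_def K(1) scaleC_add_right)
    then show ?case
      unfolding Suc.IH by (simp add: K(5))
  qed
  have pow: "norm ((?K ^^ k) u) \<le> \<delta> ^ k * norm u" for k
  proof (induction k)
    case (Suc k)
    have "norm ((?K ^^ Suc k) u) \<le> \<delta> * norm ((?K ^^ k) u)"
      using norm_tail_op_le by simp
    also have "\<dots> \<le> \<delta> * (\<delta> ^ k * norm u)"
      using Suc \<delta>(2) by (rule mult_left_mono)
    finally show ?case
      by (simp add: mult.assoc)
  qed simp
  define r where "r = tail_solve m A w u"
  have bound: "norm (s N - r) \<le> (cmod w * \<delta>) ^ N * (norm u / (1 - cmod w * \<delta>))" for N
  proof -
    have "(s N - r) - w *\<^sub>C ?K (s N - r) = (s N - w *\<^sub>C ?K (s N)) - (r - w *\<^sub>C ?K r)"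
      by (simp add: K(2) cscale.scale_right_diff_distrib)
    also have "\<dots> = - (w ^ N *\<^sub>C (?K ^^ N) u)"
      unfolding s r_def tail_solve_eq[OF w] by simp
    finally have "(1 - cmod w * \<delta>) * norm (s N - r) \<le> cmod w ^ N * norm ((?K ^^ N) u)"
      using tail_bounded_below[OF w, of "s N - r"] by (simp add: norm_power)
    also have "\<dots> \<le> cmod w ^ N * (\<delta> ^ N * norm u)"
      by (intro mult_left_mono pow) simp
    finally show ?thesis
      using w by (simp add: field_simps power_mult_distrib)
  qed
  have "(\<lambda>N. (cmod w * \<delta>) ^ N * (norm u / (1 - cmod w * \<delta>))) \<longlonglongrightarrow> 0"
    by (rule tendsto_mult_left_zero, rule LIMSEQ_realpow_zero) (use w \<delta>(2) in auto)
  then have "(\<lambda>N. s N - r) \<longlonglongrightarrow> 0"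
    by (rule Lim_null_comparison[rotated]) (rule always_eventually, use bound in blast)
  then have "s \<longlonglongrightarrow> r"
    by (rule LIM_zero_cancel)
  then have "(\<lambda>N. cinner (s N) v) \<longlonglongrightarrow> cinner r v"
    by (rule bounded_linear.tendsto[OF bounded_linear_cinner_left])
  then show ?thesis
    by (simp add: sums_def s_def r_def cinner_sum_left cinner_scaleC_left mult.commute)
qed

lemma red_det_holomorphic:
  assumes "\<rho> * \<delta> < 1"
  shows "red_det m A holomorphic_on ball 0 \<rho>"
proof -
  have "(\<lambda>w. cinner (tail_solve m A w u) v) holomorphic_on ball 0 \<rho>" for u v
  proof (rule power_series_holomorphic)
    fix w :: complex assume "w \<in> ball 0 \<rho>"
    then have "cmod w * \<delta> \<le> \<rho> * \<delta>"
      using \<delta>(2) by (intro mult_right_mono) auto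
    then show "(\<lambda>k. cinner ((tail_op m A ^^ k) u) v * (w - 0) ^ k) sums cinner (tail_solve m A w u) v"
      using tail_solve_sums assms by simp
  qed
  then show ?thesis
    unfolding red_det_def red_matrix_def
    by (intro holomorphic_on_det holomorphic_intros)
qed

text \<open>Supplies the boundedness of the limit entries that uniform convergence of their products
  requires.\<close>

lemma red_matrix_bounded:
  assumes "\<rho> * \<delta> < 1"
  shows "bounded ((\<lambda>w. red_matrix m A w i j) ` ball 0 \<rho>)"
proof -
  have "cmod (red_matrix m A w i j) \<le> 1 + \<rho> * (norm (A (e j)) / (1 - \<rho> * \<delta>))" if "w \<in> ball 0 \<rho>" for w
  proof -
    have w: "cmod w \<le> \<rho>" "cmod w * \<delta> \<le> \<rho> * \<delta>" "0 \<le> \<rho>"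
      using that \<delta>(2) by (auto intro: mult_right_mono less_imp_le order_trans[OF norm_ge_zero])
    have "cmod (cinner (tail_solve m A w (A (e j))) (e i)) \<le> norm (tail_solve m A w (A (e j)))"
      using cinner_Cauchy_Schwarz[of "tail_solve m A w (A (e j))" "e i"] by simp
    also have "\<dots> \<le> norm (A (e j)) / (1 - cmod w * \<delta>)"
      using w assms by (intro norm_tail_solve_le) simp
    also have "\<dots> \<le> norm (A (e j)) / (1 - \<rho> * \<delta>)"
      using w assms by (intro divide_left_mono) auto
    finally have "cmod w * cmod (cinner (tail_solve m A w (A (e j))) (e i)) 
        \<le> \<rho> * (norm (A (e j)) / (1 - \<rho> * \<delta>))"
      using w by (intro mult_mono) auto
    moreover have "cmod (if i = j then 1 else 0) \<le> 1"
      by simp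
    ultimately show ?thesis
      unfolding red_matrix_def by (intro order_trans[OF norm_triangle_ineq4] add_mono) (simp_all add: norm_mult)
  qed
  then show ?thesis
    unfolding bounded_iff by blast
qed

end

text \<open>The bound is linear in \<open>\<epsilon>\<close> with a factor built only from
  \<open>A\<close>, \<open>\<rho>\<close> and \<open>\<delta>\<close>; hence it is uniform on the
  disc and the same for all members of a sequence approaching \<open>A\<close>.\<close>

lemma red_matrix_perturb:
  assumes A: "bounded_clinear A" "\<And>x. norm (A (x - proj m x)) \<le> \<delta> * norm x"
    and B: "bounded_clinear B" "\<And>x. norm (B (x - proj m x)) \<le> \<delta> * norm x"
    and \<delta>: "0 \<le> \<delta>" and \<epsilon>: "\<And>x. norm (B x - A x) \<le> \<epsilon> * norm x" "0 \<le> \<epsilon>" "\<epsilon> \<le> 1"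
    and w: "cmod w \<le> \<rho>" "\<rho> * \<delta> < 1"
  shows "cmod (red_matrix m B w i j - red_matrix m A w i j)
    \<le> \<epsilon> * (\<rho> * ((1 + \<rho> * ((norm (A (e j)) + 1) / (1 - \<rho> * \<delta>))) / (1 - \<rho> * \<delta>)))"
proof -
  have \<rho>: "0 \<le> \<rho>" and w\<delta>: "cmod w * \<delta> \<le> \<rho> * \<delta>" "cmod w * \<delta> < 1"
    using w \<delta> order_trans[OF norm_ge_zero w(1)] mult_right_mono[OF w(1) \<delta>] by auto
  define q where "q = 1 - \<rho> * \<delta>"
  have q: "0 < q" "q \<le> 1 - cmod w * \<delta>"
    using w w\<delta> by (auto simp: q_def)
  define r where "r = tail_solve m A w (A (e j))"
  define r' where "r' = tail_solve m B w (B (e j))"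
  have "norm (B (e j)) \<le> norm (A (e j)) + norm (B (e j) - A (e j))"
    by (metis add.commute diff_add_cancel norm_triangle_ineq)
  also have "norm (B (e j) - A (e j)) \<le> 1"
    using \<epsilon>(1)[of "e j"] \<epsilon>(3) by simp
  finally have Be: "norm (B (e j)) \<le> norm (A (e j)) + 1"
    by simp
  have "norm r' \<le> norm (B (e j)) / (1 - cmod w * \<delta>)"
    unfolding r'_def by (rule norm_tail_solve_le[OF B \<delta> w\<delta>(2)])
  also have "\<dots> \<le> (norm (A (e j)) + 1) / q"
    using q Be by (intro frac_le) auto
  finally have r': "norm r' \<le> (norm (A (e j)) + 1) / q" .
  have r_eq: "A (e j) = r - w *\<^sub>C tail_op m A r"
    unfolding r_def by (rule tail_solve_eq[OF A \<delta> w\<delta>(2), symmetric])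
  have r'_eq: "B (e j) = r' - w *\<^sub>C tail_op m B r'"
    unfolding r'_def by (rule tail_solve_eq[OF B \<delta> w\<delta>(2), symmetric])
  \<comment> \<open>A second resolvent identity: subtracting the two defining equations leaves only
    terms containing \<open>B - A\<close>, and the tail bound of \<open>A\<close> then controls
    \<open>r' - r\<close>.\<close>
  have "(r' - r) - w *\<^sub>C tail_op m A (r' - r)
      = (B (e j) - A (e j)) + w *\<^sub>C (B (r' - proj m r') - A (r' - proj m r'))"
    unfolding tail_op_def[symmetric] r_eq r'_eq bounded_clinearD(2)[OF bounded_clinear_tail_op[OF A \<delta>]]
    by (simp add: cscale.scale_right_diff_distrib)
  then have "(1 - cmod w * \<delta>) * norm (r' - r)
      \<le> norm ((B (e j) - A (e j)) + w *\<^sub>C (B (r' - proj m r') - A (r' - proj m r')))"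
    using tail_bounded_below[OF A \<delta> w\<delta>(2), of "r' - r"] by simp
  also have "\<dots> \<le> norm (B (e j) - A (e j)) + cmod w * norm (B (r' - proj m r') - A (r' - proj m r'))"
    by (rule order_trans[OF norm_triangle_ineq]) simp
  also have "\<dots> \<le> \<epsilon> + \<rho> * (\<epsilon> * ((norm (A (e j)) + 1) / q))"
  proof (intro add_mono mult_mono w(1) \<rho>)
    show "norm (B (e j) - A (e j)) \<le> \<epsilon>"
      using \<epsilon>(1)[of "e j"] by simp
    have "norm (B (r' - proj m r') - A (r' - proj m r')) \<le> \<epsilon> * norm (r' - proj m r')"
      by (rule \<epsilon>(1))
    also have "\<dots> \<le> \<epsilon> * ((norm (A (e j)) + 1) / q)"
      by (intro mult_left_mono order_trans[OF norm_diff_proj_le r'] \<epsilon>(2))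
    finally show "norm (B (r' - proj m r') - A (r' - proj m r')) \<le> \<epsilon> * ((norm (A (e j)) + 1) / q)" .
  qed simp
  finally have "q * norm (r' - r) \<le> \<epsilon> * (1 + \<rho> * ((norm (A (e j)) + 1) / q))"
    using mult_right_mono[OF q(2) norm_ge_zero[of "r' - r"]] by (simp add: algebra_simps)
  then have rr: "norm (r' - r) \<le> \<epsilon> * ((1 + \<rho> * ((norm (A (e j)) + 1) / q)) / q)"
    using q(1) by (simp add: pos_le_divide_eq mult.commute)
  have "red_matrix m B w i j - red_matrix m A w i j = - (w * cinner (r' - r) (e i))"
    by (simp add: red_matrix_def r_def r'_def cinner_diff_left algebra_simps)
  then have "cmod (red_matrix m B w i j - red_matrix m A w i j) = cmod w * cmod (cinner (r' - r) (e i))"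
    by (simp add: norm_mult)
  also have "\<dots> \<le> \<rho> * norm (r' - r)"
    using cinner_Cauchy_Schwarz[of "r' - r" "e i"] w(1) \<rho> by (intro mult_mono) auto
  also have "\<dots> \<le> \<rho> * (\<epsilon> * ((1 + \<rho> * ((norm (A (e j)) + 1) / q)) / q))"
    by (intro mult_left_mono rr \<rho>)
  finally show ?thesis
    by (simp add: q_def mult_ac)
qed

text \<open>Hurwitz's theorem is applied to the reduced determinants on a small disc around the
  reciprocal of \<open>l\<close>. They do not vanish identically because they equal \<open>1\<close> at the origin.\<close>

lemma spectrum_gap_limit:
  assumes T: "bounded_clinear T" and S: "\<And>n. bounded_clinear (S n)"
    and lim: "\<And>\<epsilon>. 0 < \<epsilon> \<Longrightarrow> \<forall>\<^sub>F n in sequentially. \<forall>x. norm (S n x - T x) \<le> \<epsilon> * norm x"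
    and tail: "\<And>\<epsilon>. 0 < \<epsilon> \<Longrightarrow> \<exists>m. \<forall>x. norm (T (x - proj m x)) \<le> \<epsilon> * norm x"
    and "l \<noteq> 0" "0 < r" and gap: "\<And>n. spectrum (S n) \<inter> ball l r = {}"
  shows "l \<notin> spectrum T"
proof -
  \<comment> \<open>These give \<open>\<rho> * \<delta> = 1 / 2\<close>, while the reciprocal of
    \<open>l\<close>, of modulus \<open>\<rho> / 2\<close>, lies well inside the disc of radius
    \<open>\<rho>\<close>.\<close>
  define \<delta> where "\<delta> = cmod l / 4"
  define \<rho> where "\<rho> = 2 / cmod l"
  have \<delta>: "0 < \<delta>" "0 \<le> \<delta>" and \<rho>\<delta>: "\<rho> * \<delta> < 1" and \<rho>: "0 < \<rho>"
    using assms(5) by (auto simp: \<delta>_def \<rho>_def)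
  \<comment> \<open>Half of \<open>\<delta>\<close> is kept in reserve: a perturbation of size
    \<open>\<delta> / 2\<close> leaves the tails of late \<open>S n\<close> below
    \<open>\<delta>\<close> with the same \<open>m\<close>.\<close>
  obtain m where m: "\<And>x. norm (T (x - proj m x)) \<le> \<delta> / 2 * norm x"
    using tail[of "\<delta> / 2"] \<delta> by auto
  have T_tail: "norm (T (x - proj m x)) \<le> \<delta> * norm x" for x
    using m[of x] \<delta> by (simp add: field_simps) (smt (verit) mult_nonneg_nonneg norm_ge_zero)
  obtain N where N: "\<And>n x. n \<ge> N \<Longrightarrow> norm (S n x - T x) \<le> \<delta> / 2 * norm x"
    using lim[of "\<delta> / 2"] \<delta> by (auto simp: eventually_sequentially)
  define U where "U n = S (n + N)" for n
  have U: "bounded_clinear (U n)" for n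
    by (simp add: U_def S)
  have U_tail: "norm (U n (x - proj m x)) \<le> \<delta> * norm x" for n x
  proof -
    have "norm (U n (x - proj m x)) \<le> norm (T (x - proj m x)) + norm (U n (x - proj m x) - T (x - proj m x))"
      by (metis add.commute diff_add_cancel norm_triangle_ineq)
    also have "\<dots> \<le> \<delta> / 2 * norm x + \<delta> / 2 * norm (x - proj m x)"
      unfolding U_def by (intro add_mono m N) simp
    also have "\<dots> \<le> \<delta> / 2 * norm x + \<delta> / 2 * norm x"
      using \<delta> by (intro add_left_mono mult_left_mono norm_diff_proj_le) simp
    finally show ?thesis
      by simp
  qed
  have U_lim: "\<forall>\<^sub>F n in sequentially. \<forall>x. norm (U n x - T x) \<le> \<epsilon> * norm x" if "0 < \<epsilon>" for \<epsilon>
    unfolding U_def using lim[OF that] sequentially_offset by fastforce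
  have "(inverse \<longlongrightarrow> inverse (inverse l)) (at (inverse l))"
    using assms(5) by (intro tendsto_intros) simp
  then have "\<forall>\<^sub>F w in nhds (inverse l). dist (inverse w) l < r"
    using assms(5,6) tendstoD[of inverse "inverse (inverse l)" _ r] by (simp add: eventually_nhds_conv_at)
  then obtain s where s: "0 < s" "\<And>w. dist w (inverse l) < s \<Longrightarrow> dist (inverse w) l < r"
    by (auto simp: eventually_nhds_metric)
  \<comment> \<open>The bound \<open>s\<close> makes inversion map the disc into
    \<open>ball l r\<close>; the bound \<open>1 / cmod l\<close> keeps 0 out of the open disc and
    the disc inside \<open>ball 0 \<rho>\<close>.\<close>
  define t where "t = min s (1 / cmod l)"
  define D where "D = ball (inverse l) t"
  have t: "0 < t" "t \<le> s" "t \<le> 1 / cmod l"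
    using s(1) assms(5) by (auto simp: t_def)
  have D_sub: "D \<subseteq> ball 0 \<rho>"
  proof
    fix w assume "w \<in> D"
    then have "cmod (w - inverse l) < t"
      by (simp add: D_def dist_norm norm_minus_commute)
    then have "cmod w < cmod (inverse l) + t"
      by (metis add.commute add_less_cancel_right diff_add_cancel le_less_trans norm_triangle_ineq)
    then show "w \<in> ball 0 \<rho>"
      using t(3) by (simp add: \<rho>_def norm_divide inverse_eq_divide)
  qed
  have D_small: "cmod w * \<delta> < 1" if "w \<in> ball 0 \<rho>" for w
  proof -
    have "cmod w * \<delta> \<le> \<rho> * \<delta>"
      using that \<delta> by (intro mult_right_mono) auto
    then show ?thesis
      using \<rho>\<delta> by simp
  qed
  have l_D: "inverse l \<in> D"
    using t by (simp add: D_def)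
  have nz: "red_det m (U n) w \<noteq> 0" if "w \<in> D" for n w
  proof -
    have "w \<noteq> 0"
    proof
      assume "w = 0"
      with that have "cmod (inverse l) < t"
        by (simp add: D_def dist_norm)
      then show False
        using t(3) by (simp add: norm_divide inverse_eq_divide)
    qed
    have "inverse w \<in> ball l r"
      using s(2)[of w] that t(2) by (simp add: D_def dist_commute)
    then have "inverse w \<notin> spectrum (U n)"
      using gap[of "n + N"] by (auto simp: U_def)
    then have "regular (\<lambda>x. x - w *\<^sub>C U n x)"
      using spectrum_iff_resolvent[OF U \<open>w \<noteq> 0\<close>] by blast
    then show ?thesis
      using regular_iff_red_det[OF U U_tail \<delta>(2) D_small] that D_sub by blast
  qed
  have hol_T: "red_det m T holomorphic_on ball 0 \<rho>"
    by (rule red_det_holomorphic[OF T T_tail \<delta>(2) \<rho>\<delta>])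
  have unif: "uniform_limit (ball 0 \<rho>) (\<lambda>n. red_det m (U n)) (red_det m T) sequentially"
    unfolding red_det_def
  proof (rule uniform_limit_det)
    fix i j
    show "bounded ((\<lambda>w. red_matrix m T w i j) ` ball 0 \<rho>)"
      by (rule red_matrix_bounded[OF T T_tail \<delta>(2) \<rho>\<delta>])
    define C where "C = \<rho> * ((1 + \<rho> * ((norm (T (e j)) + 1) / (1 - \<rho> * \<delta>))) / (1 - \<rho> * \<delta>))"
    have C: "0 < C"
      unfolding C_def using \<rho> \<rho>\<delta> by (intro mult_pos_pos divide_pos_pos add_pos_nonneg) auto
    show "uniform_limit (ball 0 \<rho>) (\<lambda>n w. red_matrix m (U n) w i j) (\<lambda>w. red_matrix m T w i j) sequentially"
    proof (rule uniform_limitI)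
      fix \<epsilon> :: real assume "0 < \<epsilon>"
      define \<eta> where "\<eta> = min 1 (\<epsilon> / (2 * C))"
      have \<eta>: "0 < \<eta>" "\<eta> \<le> 1" "\<eta> * C < \<epsilon>"
      proof -
        show "0 < \<eta>" "\<eta> \<le> 1"
          using \<open>0 < \<epsilon>\<close> C by (auto simp: \<eta>_def)
        have "\<eta> * C \<le> \<epsilon> / (2 * C) * C"
          using C by (intro mult_right_mono) (auto simp: \<eta>_def)
        then show "\<eta> * C < \<epsilon>"
          using C \<open>0 < \<epsilon>\<close> by simp
      qed
      from U_lim[OF \<eta>(1)]
      show "\<forall>\<^sub>F n in sequentially. \<forall>w\<in>ball 0 \<rho>. dist (red_matrix m (U n) w i j) (red_matrix m T w i j) < \<epsilon>"
      proof eventually_elim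
        case (elim n)
        show ?case
        proof
          fix w :: complex assume "w \<in> ball 0 \<rho>"
          then have "cmod w \<le> \<rho>"
            by simp
          from red_matrix_perturb[OF T T_tail U U_tail \<delta>(2) _ _ \<eta>(2) this \<rho>\<delta>, of n i j] elim \<eta>
          show "dist (red_matrix m (U n) w i j) (red_matrix m T w i j) < \<epsilon>"
            unfolding C_def[symmetric] dist_norm by fastforce
        qed
      qed
    qed
  qed
  have "red_det m T (inverse l) \<noteq> 0"
  \<comment> \<open>Hurwitz's theorem is stated for nonconstant limits. A constant limit is treated
    by continuing the value 0 analytically from the disc to the origin.\<close>
  proof (cases "red_det m T constant_on D")
    case True
    then obtain k where k: "\<And>w. w \<in> D \<Longrightarrow> red_det m T w = k"
      by (auto simp: constant_on_def)
    have "k \<noteq> 0"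
    proof
      assume "k = 0"
      have "inverse l islimpt D"
        using t(1) by (simp add: D_def interior_limit_point)
      then have "red_det m T 0 = 0"
        using analytic_continuation[OF hol_T open_ball connected_ball D_sub, of "inverse l" 0]
          l_D D_sub k \<open>k = 0\<close> \<rho> by auto
      then show False
        by (simp add: red_det_0)
    qed
    then show ?thesis
      using k[OF l_D] by simp
  next
    case False
    show ?thesis
    proof (rule Hurwitz_no_zeros[of D "\<lambda>n. red_det m (U n)" "red_det m T" "inverse l"])
      show "red_det m (U n) holomorphic_on D" for n
        by (rule holomorphic_on_subset[OF red_det_holomorphic[OF U U_tail \<delta>(2) \<rho>\<delta>] D_sub])
      show "red_det m T holomorphic_on D"
        by (rule holomorphic_on_subset[OF hol_T D_sub])
      show "uniform_limit K (\<lambda>n. red_det m (U n)) (red_det m T) sequentially" if "K \<subseteq> D" for K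
        by (rule uniform_limit_on_subset[OF unif]) (use that D_sub in blast)
    qed (use False nz l_D in \<open>auto simp: D_def\<close>)
  qed
  then have "regular (\<lambda>x. x - inverse l *\<^sub>C T x)"
    using regular_iff_red_det[OF T T_tail \<delta>(2) D_small] l_D D_sub by blast
  then show ?thesis
    using spectrum_iff_resolvent[OF T, of "inverse l"] assms(5) by simp
qed

end

section \<open>Semicontinuity in terms of spectral distances\<close>

context hilbert_basis
begin

text \<open>Otherwise bad spectral points, all in one fixed ball, accumulate at some
  \<open>l\<close>, which \<open>spectrum_limit\<close> puts into the spectrum of \<open>T\<close>
  although the points stay \<open>\<epsilon>\<close> away from it.\<close>

lemma spectrum_upper_semicontinuous:
  assumes T: "bounded_clinear T" and S: "\<And>n. bounded_clinear (S n)"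
    and lim: "\<And>\<epsilon>. 0 < \<epsilon> \<Longrightarrow> \<forall>\<^sub>F n in sequentially. \<forall>x. norm (S n x - T x) \<le> \<epsilon> * norm x"
    and "0 < \<epsilon>"
  shows "\<forall>\<^sub>F n in sequentially. \<forall>z\<in>spectrum (S n). \<exists>w\<in>spectrum T. dist z w < \<epsilon>"
proof -
  obtain C where C: "0 < C" "\<And>x. norm (T x) \<le> C * norm x"
    using bounded_clinear_bound[OF T] by blast
  have bd: "cmod z \<le> C + 1" if "\<forall>x. norm (S n x - T x) \<le> 1 * norm x" "z \<in> spectrum (S n)" for n z
  proof (rule spectrum_norm_le[OF S _ _ that(2)])
    fix x
    have "norm (S n x) \<le> norm (T x) + norm (S n x - T x)"
      by (metis add.commute diff_add_cancel norm_triangle_ineq)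
    then show "norm (S n x) \<le> (C + 1) * norm x"
      using C(2)[of x] spec[OF that(1), of x] by (simp add: distrib_right)
  qed (use C in simp)
  \<comment> \<open>With the norm bound as a premise, the negation yields a bad point together with
    the bound that confines it to \<open>cball 0 (C + 1)\<close>.\<close>
  let ?P = "\<lambda>n. (\<forall>x. norm (S n x - T x) \<le> 1 * norm x) \<longrightarrow> (\<forall>z\<in>spectrum (S n). \<exists>w\<in>spectrum T. dist z w < \<epsilon>)"
  have "eventually ?P sequentially"
  proof (rule ccontr)
    assume "\<not> eventually ?P sequentially"
    from not_eventually_sequentiallyD[OF this]
    obtain r :: "nat \<Rightarrow> nat" where r: "strict_mono r" "\<And>n. \<not> ?P (r n)"
      by blast
    have "\<exists>z. z \<in> spectrum (S (r n)) \<and> z \<in> cball 0 (C + 1) \<and> (\<forall>w\<in>spectrum T. \<epsilon> \<le> dist z w)" for n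
    proof -
      obtain z where "\<forall>x. norm (S (r n) x - T x) \<le> 1 * norm x" "z \<in> spectrum (S (r n))"
        "\<forall>w\<in>spectrum T. \<epsilon> \<le> dist z w"
        using r(2)[of n] by (auto simp: not_less)
      then show ?thesis
        using bd[of "r n" z] by auto
    qed
    then obtain z where z: "\<And>n. z n \<in> spectrum (S (r n))" "\<And>n. z n \<in> cball 0 (C + 1)"
      "\<And>n w. w \<in> spectrum T \<Longrightarrow> \<epsilon> \<le> dist (z n) w"
      by metis
    obtain l s where s: "strict_mono s" "(z \<circ> s) \<longlonglongrightarrow> l"
      using compact_cball[of 0 "C + 1"] z(2) unfolding compact_def by metis
    have "l \<in> spectrum T"
    proof (rule spectrum_limit[OF T, of "\<lambda>n. S (r (s n))"])
      show "\<forall>\<^sub>F n in sequentially. \<forall>x. norm (S (r (s n)) x - T x) \<le> \<eta> * norm x" if "0 < \<eta>" for \<eta>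
        using eventually_subseq[OF s(1) eventually_subseq[OF r(1) lim[OF that]]] .
      show "(\<lambda>n. z (s n)) \<longlonglongrightarrow> l"
        using s(2) by (simp add: o_def)
    qed (simp_all add: S z(1))
    moreover have "\<exists>n. dist (z (s n)) l < \<epsilon>"
      using tendstoD[OF s(2) assms(4)] by (auto simp: eventually_sequentially)
    ultimately show False
      using z(3) by (meson not_le)
  qed
  moreover have "\<forall>\<^sub>F n in sequentially. \<forall>x. norm (S n x - T x) \<le> 1 * norm x"
    by (rule lim) simp
  ultimately show ?thesis
    by eventually_elim blast
qed

text \<open>Otherwise missed points of the compact spectrum of \<open>T\<close> accumulate at a
  point \<open>l\<close> of it, and along a subsequence a whole ball around \<open>l\<close> is free
  of spectrum, against \<open>spectrum_gap_limit\<close>.\<close>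

lemma spectrum_lower_semicontinuous:
  assumes T: "bounded_clinear T" and S: "\<And>n. bounded_clinear (S n)"
    and lim: "\<And>\<epsilon>. 0 < \<epsilon> \<Longrightarrow> \<forall>\<^sub>F n in sequentially. \<forall>x. norm (S n x - T x) \<le> \<epsilon> * norm x"
    and tail: "\<And>\<epsilon>. 0 < \<epsilon> \<Longrightarrow> \<exists>m. \<forall>x. norm (T (x - proj m x)) \<le> \<epsilon> * norm x"
    and zero: "\<And>n. 0 \<in> spectrum (S n)"
    and "0 < \<epsilon>"
  shows "\<forall>\<^sub>F n in sequentially. \<forall>w\<in>spectrum T. \<exists>z\<in>spectrum (S n). dist z w < \<epsilon>" (is "eventually ?P _")
proof (rule ccontr)
  assume "\<not> eventually ?P sequentially"
  from not_eventually_sequentiallyD[OF this]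
  obtain r :: "nat \<Rightarrow> nat" where r: "strict_mono r" "\<And>n. \<not> ?P (r n)"
    by blast
  then have "\<exists>w\<in>spectrum T. \<forall>z\<in>spectrum (S (r n)). \<epsilon> \<le> dist z w" for n
    by (auto simp: not_less)
  then obtain w where w: "\<And>n. w n \<in> spectrum T" "\<And>n z. z \<in> spectrum (S (r n)) \<Longrightarrow> \<epsilon> \<le> dist z (w n)"
    by metis
  obtain l s where s: "l \<in> spectrum T" "strict_mono s" "(w \<circ> s) \<longlonglongrightarrow> l"
    using compact_spectrum[OF T] w(1) unfolding compact_def by metis
  obtain N where N: "\<And>n. n \<ge> N \<Longrightarrow> dist (w (s n)) l < \<epsilon> / 2"
    using tendstoD[OF s(3), of "\<epsilon> / 2"] assms(6) by (auto simp: eventually_sequentially)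
  \<comment> \<open>The shift by \<open>N\<close> brings \<open>w\<close> within
    \<open>\<epsilon> / 2\<close> of \<open>l\<close> for every index; the other half of
    \<open>\<epsilon>\<close> remains as the radius of the gap.\<close>
  define R where "R n = S (r (s (n + N)))" for n
  have gap: "spectrum (R n) \<inter> ball l (\<epsilon> / 2) = {}" for n
  proof -
    have False if "z \<in> spectrum (R n)" "dist l z < \<epsilon> / 2" for z
      using w(2)[of z "s (n + N)"] that N[of "n + N"] dist_triangle[of z "w (s (n + N))" l]
      by (simp add: R_def dist_commute)
    then show ?thesis
      by auto
  qed
  have "l \<noteq> 0"
    using gap[of 0] zero assms(6) by (force simp: R_def)
  moreover have "\<forall>\<^sub>F n in sequentially. \<forall>x. norm (R n x - T x) \<le> \<eta> * norm x" if "0 < \<eta>" for \<eta>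
    using eventually_subseq[OF s(2) eventually_subseq[OF r(1) lim[OF that]]]
    unfolding R_def by (rule sequentially_offset)
  ultimately have "l \<notin> spectrum T"
    using assms(6) gap
    by (intro spectrum_gap_limit[OF T _ _ tail, of R l "\<epsilon> / 2"]) (simp_all add: R_def S)
  then show False
    using s(1) by blast
qed

end

section \<open>Bounds for the Attouch-Wets distance\<close>

text \<open>One half of the Hausdorff estimate; with \<open>\<epsilon>\<close> moved to the left it
  is a lower bound for an infimum.\<close>

lemma ext_dist_le_add:
  assumes "\<And>b. b \<in> B \<Longrightarrow> \<exists>a\<in>A. dist a b \<le> \<epsilon>"
  shows "ext_dist x A \<le> ext_dist x B + ereal \<epsilon>"
proof -
  have "ext_dist x A - ereal \<epsilon> \<le> ext_dist x B"
    unfolding ext_dist_def[of x B]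
  proof (rule INF_greatest)
    fix b assume "b \<in> B"
    then obtain a where a: "a \<in> A" "dist a b \<le> \<epsilon>"
      using assms by blast
    have "norm (a - x) \<le> norm (b - x) + \<epsilon>"
      using a(2) norm_triangle_ineq[of "a - b" "b - x"] by (simp add: dist_norm)
    moreover have "ext_dist x A \<le> ereal (norm (a - x))"
      unfolding ext_dist_def by (rule INF_lower[OF a(1)])
    ultimately have "ext_dist x A \<le> ereal (norm (b - x) + \<epsilon>)"
      using ereal_less_eq(3) order_trans by blast
    then show "ext_dist x A - ereal \<epsilon> \<le> ereal (norm (b - x))"
      by (cases "ext_dist x A") auto
  qed
  then show ?thesis
    by (cases "ext_dist x A"; cases "ext_dist x B") auto
qed

lemma ext_dist_finite:
  assumes "A \<noteq> {}"
  obtains r where "ext_dist x A = ereal r"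
proof -
  obtain a where "a \<in> A"
    using assms by blast
  then have "ext_dist x A \<le> ereal (norm (a - x))"
    unfolding ext_dist_def by (rule INF_lower)
  moreover have "0 \<le> ext_dist x A"
    unfolding ext_dist_def by (rule INF_greatest) simp
  ultimately show ?thesis
    using that by (cases "ext_dist x A") auto
qed

text \<open>The gap is at most \<open>\<epsilon>\<close> at every point, and the weights sum to 1.
  Nonemptiness makes the distances finite.\<close>

lemma attouch_wets_le:
  assumes "A \<noteq> {}" "B \<noteq> {}"
    and AB: "\<And>a. a \<in> A \<Longrightarrow> \<exists>b\<in>B. dist a b \<le> \<epsilon>" "\<And>b. b \<in> B \<Longrightarrow> \<exists>a\<in>A. dist a b \<le> \<epsilon>"
  shows "0 \<le> attouch_wets A B" "attouch_wets A B \<le> \<epsilon>"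
proof -
  have \<epsilon>: "0 \<le> \<epsilon>"
    using assms by (meson all_not_in_conv order_trans zero_le_dist)
  define c where "c m = real_of_ereal
     (min 1 (SUP x\<in>{x. norm x < real (Suc m)}. ext_gap (ext_dist x A) (ext_dist x B)))" for m
  have gap: "0 \<le> ext_gap (ext_dist x A) (ext_dist x B)"
    "ext_gap (ext_dist x A) (ext_dist x B) \<le> ereal \<epsilon>" for x
  proof -
    obtain a b where ab: "ext_dist x A = ereal a" "ext_dist x B = ereal b"
      using ext_dist_finite assms(1,2) by metis
    have "ereal a \<le> ereal b + ereal \<epsilon>" "ereal b \<le> ereal a + ereal \<epsilon>"
      using ext_dist_le_add[of B A \<epsilon> x] ext_dist_le_add[of A B \<epsilon> x] AB
      by (auto simp: ab dist_commute)
    then show "0 \<le> ext_gap (ext_dist x A) (ext_dist x B)"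
      "ext_gap (ext_dist x A) (ext_dist x B) \<le> ereal \<epsilon>"
      using \<epsilon> by (auto simp: ab ext_gap_def)
  qed
  have c: "0 \<le> c m \<and> c m \<le> \<epsilon>" for m
  proof -
    define s where "s = (SUP x\<in>{x. norm x < real (Suc m)}. ext_gap (ext_dist x A) (ext_dist x B))"
    have "s \<le> ereal \<epsilon>"
      unfolding s_def by (rule SUP_least) (rule gap)
    \<comment> \<open>The origin lies in every ball, since the radii start at 1; so the supremum is
      taken over a nonempty set and is nonnegative.\<close>
    moreover have "ext_gap (ext_dist 0 A) (ext_dist 0 B) \<le> s"
      unfolding s_def by (rule SUP_upper) simp
    then have "0 \<le> s"
      using gap(1) order_trans by blast
    ultimately show ?thesis
      unfolding c_def s_def[symmetric] by (cases s) (auto simp: min_def one_ereal_def)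
  qed
  have half: "(\<lambda>m. (1/2::real) ^ Suc m * \<epsilon>) sums (1 * \<epsilon>)"
    by (rule sums_mult2[OF power_half_series])
  have "summable (\<lambda>m. (1/2) ^ Suc m * c m)"
  proof (rule summable_comparison_test'[OF sums_summable[OF half]])
    show "norm ((1/2) ^ Suc m * c m) \<le> (1/2) ^ Suc m * \<epsilon>" for m
      using c[of m] by (simp add: abs_mult)
  qed
  moreover have "attouch_wets A B = (\<Sum>m. (1/2) ^ Suc m * c m)"
    by (simp add: attouch_wets_def c_def)
  ultimately show "0 \<le> attouch_wets A B" "attouch_wets A B \<le> \<epsilon>"
    using c suminf_le[of "\<lambda>m. (1/2) ^ Suc m * c m" "\<lambda>m. (1/2) ^ Suc m * \<epsilon>"] half
    by (auto simp: sums_iff intro!: suminf_nonneg)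
qed

section \<open>Computation trees\<close>

text \<open>All tests are asked on every path, and \<open>out\<close> receives the complete list of
  answers; a leaf may thus depend on the answers in an arbitrary way.\<close>

primrec decision_tree :: "(arith \<times> arith) list \<Rightarrow> (bool list \<Rightarrow> arith list) \<Rightarrow> comp_tree" where
  "decision_tree [] out = Output (out [])"
| "decision_tree (t # ts) out = If_le (fst t) (snd t)
     (decision_tree ts (\<lambda>bs. out (True # bs))) (decision_tree ts (\<lambda>bs. out (False # bs)))"

definition outcomes :: "(arith \<times> arith) list \<Rightarrow> inf_matrix \<Rightarrow> bool list" where
  "outcomes ts x = map (\<lambda>(p, q). Re (arith_val x p) \<le> Re (arith_val x q)) ts"

lemma run_decision_tree: "run x (decision_tree ts out) = arith_val x ` set (out (outcomes ts x))"
  by (induction ts arbitrary: out) (auto simp: outcomes_def)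

text \<open>Only rational constants are available, so the imaginary unit is obtained as the
  principal square root of -1.\<close>

definition imag_unit :: arith where
  "imag_unit = Radical 1 (Const (-1))"

lemma arith_val_imag_unit [simp]: "arith_val x imag_unit = \<i>"
proof -
  have "exp (\<i> * complex_of_real pi / 2) = \<i>"
    using cis_conv_exp[of "pi / 2"] by simp
  then show ?thesis
    by (simp add: imag_unit_def powr_def)
qed

lemma of_rat_complex: "(of_rat q :: complex) = of_real (of_rat q)"
  by (cases q) (simp add: of_rat_rat)

lemma constant_arith_dense:
  assumes "0 < \<epsilon>"
  shows "\<exists>p. \<forall>x. dist (arith_val x p) z < \<epsilon>"
proof -
  obtain a b :: rat where ab: "Re z < of_rat a" "of_rat a < Re z + \<epsilon> / 2"
    "Im z < of_rat b" "of_rat b < Im z + \<epsilon> / 2"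
    using of_rat_dense[of "Re z" "Re z + \<epsilon> / 2"] of_rat_dense[of "Im z" "Im z + \<epsilon> / 2"] assms
    by auto
  have "dist (arith_val x (Plus (Const a) (Times imag_unit (Const b)))) z < \<epsilon>" for x
    using cmod_le[of "of_rat a + \<i> * of_rat b - z"] ab
    by (simp add: dist_norm of_rat_complex)
  then show ?thesis
    by blast
qed

text \<open>Two-sided closeness in the sense of Hausdorff. The quantifier over \<open>x\<close>
  replaces a syntactic notion of constant: one list must serve every input.\<close>

definition approximates :: "real \<Rightarrow> complex set \<Rightarrow> arith list \<Rightarrow> bool" where
  "approximates \<epsilon> K ps \<longleftrightarrow> (\<forall>x. (\<forall>p\<in>set ps. \<exists>k\<in>K. dist (arith_val x p) k < \<epsilon>) \<and>
     (\<forall>k\<in>K. \<exists>p\<in>set ps. dist (arith_val x p) k < \<epsilon>))"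

text \<open>Replace the centres of a finite net by constant expressions. The centres are taken
  inside \<open>K\<close>, so that every output is close to \<open>K\<close> as well.\<close>

lemma compact_approximates:
  assumes "compact K" "0 < \<epsilon>"
  shows "\<exists>ps. approximates \<epsilon> K ps"
proof -
  obtain F where F: "finite F" "F \<subseteq> K" "K \<subseteq> (\<Union>k\<in>F. ball k (\<epsilon> / 2))"
    using seq_compact_imp_totally_bounded[OF compact_imp_seq_compact[OF assms(1)]] assms(2)
    by (meson half_gt_zero)
  have "\<forall>k. \<exists>p. \<forall>x. dist (arith_val x p) k < \<epsilon> / 2"
    using constant_arith_dense[of "\<epsilon> / 2"] assms(2) by simp
  then obtain f where f: "\<And>k x. dist (arith_val x (f k)) k < \<epsilon> / 2"
    by metis
  obtain ps where ps: "set ps = f ` F"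
    using F(1) by (metis finite_imageI finite_list)
  have "approximates \<epsilon> K ps"
    unfolding approximates_def ps
  proof (intro allI conjI ballI)
    fix x p assume "p \<in> f ` F"
    then obtain k where "k \<in> F" "p = f k"
      by blast
    then show "\<exists>k\<in>K. dist (arith_val x p) k < \<epsilon>"
      using F(2) f[of x k] assms(2) by (intro bexI[of _ k]) auto
  next
    fix x k assume "k \<in> K"
    then obtain k' where k': "k' \<in> F" "dist k' k < \<epsilon> / 2"
      using F(3) by auto
    then show "\<exists>p\<in>f ` F. dist (arith_val x p) k < \<epsilon>"
      using f[of x k'] dist_triangle[of "arith_val x (f k')" k k'] by force
  qed
  then show ?thesis ..
qed

section \<open>Rounding by comparisons\<close>

text \<open>The thresholds have spacing \<open>1 / (n+1)^3\<close> and run from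
  \<open>-(n+1)\<close> to \<open>n+1\<close>.\<close>

definition grid_tests :: "nat \<Rightarrow> arith \<Rightarrow> (arith \<times> arith) list" where
  "grid_tests n p = map (\<lambda>l. (p, Const (of_int l / of_nat ((n + 1) ^ 3)))) [- ((int n + 1) ^ 4)..(int n + 1) ^ 4]"

text \<open>Comparisons see only real parts; multiplication by the imaginary unit exposes the
  imaginary part, up to sign.\<close>

definition entry_tests :: "nat \<Rightarrow> (arith \<times> arith) list" where
  "entry_tests n = concat [grid_tests n (Entry i j) @ grid_tests n (Times imag_unit (Entry i j)).
     i \<leftarrow> [0..<n], j \<leftarrow> [0..<n]]"

text \<open>Two neighbouring thresholds enclose \<open>r\<close> in a half-open cell, and equal
  answers put \<open>s\<close> into the same cell. Only \<open>r\<close> has to be known to lie in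
  range.\<close>

lemma grid_resolution:
  fixes r s :: real
  assumes r: "\<bar>r\<bar> \<le> real n"
    and eq: "\<And>l::int. - ((int n + 1) ^ 4) \<le> l \<Longrightarrow> l \<le> (int n + 1) ^ 4 \<Longrightarrow>
      r \<le> l / real ((n + 1) ^ 3) \<longleftrightarrow> s \<le> l / real ((n + 1) ^ 3)"
  shows "\<bar>r - s\<bar> \<le> 1 / real ((n + 1) ^ 3)"
proof -
  define N where "N = int ((n + 1) ^ 3)"
  define l where "l = \<lceil>r * N\<rceil>"
  have N: "1 \<le> N"
    by (simp add: N_def)
  \<comment> \<open>The surplus \<open>N\<close> over \<open>int n * N\<close> leaves room for the
    lower threshold \<open>l - 1\<close>.\<close>
  have N4: "(int n + 1) ^ 4 = int n * N + N"
    by (simp add: N_def algebra_simps power4_eq_xxxx power3_eq_cube)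
  have rN: "r * N \<le> int n * N" "- (int n * N) \<le> r * N"
    using r N mult_right_mono[of r "real n" N] mult_right_mono[of "- real n" r N] by auto
  have l: "l \<le> int n * N" "- (int n * N) \<le> l"
    using rN by (auto simp: l_def ceiling_le_iff le_ceiling_iff)
  have lr: "r * N \<le> l" "l - 1 < r * N"
    unfolding l_def by linarith+
  have NN: "real ((n + 1) ^ 3) = N"
    by (simp add: N_def)
  have "r \<le> l / N" "\<not> r \<le> (l - 1) / N"
    using lr N by (auto simp: field_simps)
  moreover have "s \<le> l / N" "\<not> s \<le> (l - 1) / N"
    using eq[of l] eq[of "l - 1"] l N N4 calculation unfolding NN by auto
  ultimately show ?thesis
    unfolding NN by (auto simp: diff_divide_distrib abs_le_iff)
qed

lemma outcomes_grid_tests: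
  assumes eq: "outcomes ts x = outcomes ts y" and sub: "set (grid_tests n p) \<subseteq> set ts"
    and bd: "\<bar>Re (arith_val x p)\<bar> \<le> real n"
  shows "\<bar>Re (arith_val x p) - Re (arith_val y p)\<bar> \<le> 1 / real ((n + 1) ^ 3)"
proof (rule grid_resolution[OF bd])
  fix l :: int assume l: "- ((int n + 1) ^ 4) \<le> l" "l \<le> (int n + 1) ^ 4"
  define q where "q = Const (of_int l / of_nat ((n + 1) ^ 3))"
  have "(p, q) \<in> set ts"
    using sub l by (auto simp: grid_tests_def q_def)
  then have "Re (arith_val x p) \<le> Re (arith_val x q) \<longleftrightarrow> Re (arith_val y p) \<le> Re (arith_val y q)"
    using eq unfolding outcomes_def map_eq_conv by fastforce
  moreover have "Re (arith_val z q) = l / real ((n + 1) ^ 3)" for z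
    by (simp add: q_def of_rat_complex of_rat_divide del: of_nat_power of_nat_add)
  ultimately show "Re (arith_val x p) \<le> l / real ((n + 1) ^ 3) \<longleftrightarrow> Re (arith_val y p) \<le> l / real ((n + 1) ^ 3)"
    by simp
qed

lemma outcomes_entry_tests:
  assumes eq: "outcomes (entry_tests n) x = outcomes (entry_tests n) y"
    and ij: "i < n" "j < n" and bd: "cmod (x i j) \<le> real n"
  shows "cmod (x i j - y i j) \<le> 2 / real ((n + 1) ^ 3)"
proof -
  have "set (entry_tests n)
      = (\<Union>i<n. \<Union>j<n. set (grid_tests n (Entry i j)) \<union> set (grid_tests n (Times imag_unit (Entry i j))))"
    by (simp add: entry_tests_def lessThan_atLeast0)
  then have sub: "set (grid_tests n (Entry i j)) \<subseteq> set (entry_tests n)"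
    "set (grid_tests n (Times imag_unit (Entry i j))) \<subseteq> set (entry_tests n)"
    using ij by blast+
  have "\<bar>Re (x i j)\<bar> \<le> real n" "\<bar>Im (x i j)\<bar> \<le> real n"
    using bd abs_Re_le_cmod[of "x i j"] abs_Im_le_cmod[of "x i j"] by auto
  then have "\<bar>Re (x i j) - Re (y i j)\<bar> \<le> 1 / real ((n + 1) ^ 3)"
    "\<bar>Im (x i j) - Im (y i j)\<bar> \<le> 1 / real ((n + 1) ^ 3)"
    using outcomes_grid_tests[OF eq sub(1)] outcomes_grid_tests[OF eq sub(2)]
    by (simp_all add: abs_minus_commute)
  then show ?thesis
    using cmod_le[of "x i j - y i j"] by simp
qed

section \<open>Locality of computation trees\<close>

text \<open>\<open>Suc\<close> makes this a strict bound: only entries with both indices below it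
  are read.\<close>

primrec arith_bound :: "arith \<Rightarrow> nat" where
  "arith_bound (Entry i j) = Suc (max i j)"
| "arith_bound (Const q) = 0"
| "arith_bound (Plus p q) = max (arith_bound p) (arith_bound q)"
| "arith_bound (Minus p q) = max (arith_bound p) (arith_bound q)"
| "arith_bound (Times p q) = max (arith_bound p) (arith_bound q)"
| "arith_bound (Divide p q) = max (arith_bound p) (arith_bound q)"
| "arith_bound (Conj p) = arith_bound p"
| "arith_bound (Radical n p) = arith_bound p"

primrec tree_bound :: "comp_tree \<Rightarrow> nat" where
  "tree_bound (Output ps) = Max (insert 0 (arith_bound ` set ps))"
| "tree_bound (If_le p q s t) =
     max (max (arith_bound p) (arith_bound q)) (max (tree_bound s) (tree_bound t))"

lemma arith_val_local:
  assumes "\<And>i j. i < N \<Longrightarrow> j < N \<Longrightarrow> x i j = y i j" "arith_bound p \<le> N"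
  shows "arith_val x p = arith_val y p"
  using assms(2) by (induction p) (simp_all add: assms(1))

lemma run_local:
  assumes "\<And>i j. i < N \<Longrightarrow> j < N \<Longrightarrow> x i j = y i j" "tree_bound t \<le> N"
  shows "run x t = run y t"
  using assms(2)
proof (induction t)
  case (Output ps)
  then have "arith_val x p = arith_val y p" if "p \<in> set ps" for p
    using that by (intro arith_val_local[OF assms(1)]) auto
  then show ?case
    by auto
next
  case (If_le p q s t)
  then show ?case
    using arith_val_local[OF assms(1), where p = p] arith_val_local[OF assms(1), where p = q] by simp
qed

section \<open>The Solvability Complexity Index\<close>

context hilbert_basis
begin

section \<open>Lower bound: no single tree suffices\<close>

lemma compact_operator_zero: "compact_operator (\<lambda>x::'a. 0)"
proof -
  have "(\<lambda>x::'a. 0::'a) ` cball 0 1 = {0}"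
    by (simp add: image_constant_conv)
  then show ?thesis
    unfolding compact_operator_def by (simp add: bounded_clinear_intro[where C = 0])
qed

text \<open>The image of the unit ball lies in the compact set of all \<open>c *\<^sub>C e n\<close>
  with \<open>c\<close> in the closed unit disc.\<close>

lemma compact_operator_rank_one: "compact_operator (\<lambda>x. cinner x (e n) *\<^sub>C e n)"
  unfolding compact_operator_def
proof
  have le: "cmod (cinner x (e n)) \<le> norm x" for x
    using cinner_Cauchy_Schwarz[of x "e n"] by simp
  show "bounded_clinear (\<lambda>x. cinner x (e n) *\<^sub>C e n)"
    by (rule bounded_clinear_intro[where C = 1])
      (simp_all add: cinner_add_left cinner_scaleC_left scaleC_add_left le)
  have "continuous_on (cball 0 1) (\<lambda>c. c *\<^sub>C e n)"
  proof (rule linear_continuous_on, rule bounded_linear_intro[where K = 1])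
    show "(r *\<^sub>R c) *\<^sub>C e n = r *\<^sub>R c *\<^sub>C e n" for r c
      by (simp add: scaleR_conv_of_real flip: scaleC_of_real)
  qed (simp_all add: scaleC_add_left)
  then have K: "compact ((\<lambda>c. c *\<^sub>C e n) ` cball 0 1)"
    by (rule compact_continuous_image[OF _ compact_cball])
  have "(\<lambda>x. cinner x (e n) *\<^sub>C e n) ` cball 0 1 \<subseteq> (\<lambda>c. c *\<^sub>C e n) ` cball 0 1"
  proof (rule image_subsetI)
    fix x :: 'a assume "x \<in> cball 0 1"
    then have "cinner x (e n) \<in> cball 0 1"
      using le[of x] by simp
    then show "cinner x (e n) *\<^sub>C e n \<in> (\<lambda>c. c *\<^sub>C e n) ` cball 0 1"
      by (rule imageI)
  qed
  then have "closure ((\<lambda>x. cinner x (e n) *\<^sub>C e n) ` cball 0 1) \<subseteq> (\<lambda>c. c *\<^sub>C e n) ` cball 0 1"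
    by (rule closure_minimal[OF _ compact_imp_closed[OF K]])
  then show "compact (closure ((\<lambda>x. cinner x (e n) *\<^sub>C e n) ` cball 0 1))"
    using compact_Int_closed[OF K closed_closure] by (metis Int_absorb1)
qed

text \<open>A tree does not see the rank one projection onto a basis vector outside its range.\<close>

lemma not_exactly_computable: "\<not> exactly_computable e {T. compact_operator T} spectrum"
proof
  assume "exactly_computable e {T. compact_operator T} spectrum"
  then obtain t where t: "\<And>T. compact_operator T \<Longrightarrow> spectrum T = run (matrix_of e T) t"
    unfolding exactly_computable_def finitely_evaluable_on_def by force
  define n where "n = tree_bound t"
  define P where "P x = cinner x (e n) *\<^sub>C e n" for x
  have P: "compact_operator P"
    unfolding P_def by (rule compact_operator_rank_one)
  have lin: "bounded_clinear P" "bounded_clinear (\<lambda>x::'a. 0::'a)"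
    using P compact_operator_zero by (simp_all add: compact_operator_def)
  \<comment> \<open>The only nonzero entry of the matrix of \<open>P\<close> is at
    \<open>(n, n)\<close>, and \<open>t\<close> reads indices below \<open>n\<close> only.\<close>
  have "run (matrix_of e P) t = run (matrix_of e (\<lambda>x. 0)) t"
    by (rule run_local[of n]) (simp_all add: n_def matrix_of_def P_def cinner_scaleC_left cinner_basis)
  then have eq: "spectrum P = spectrum (\<lambda>x::'a. 0)"
    using t[OF P] t[OF compact_operator_zero] by simp
  have "1 \<notin> spectrum (\<lambda>x::'a. 0)"
    using spectrum_norm_le[OF lin(2), of 0 1] by auto
  moreover have "1 \<in> spectrum P"
  proof (rule ccontr)
    assume "1 \<notin> spectrum P"
    then obtain c where "0 < c" "\<And>x. c * norm x \<le> norm (P x - 1 *\<^sub>C x)"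
      by (auto simp: spectrum_iff_not_regular[OF lin(1)] regular_def bounded_below_def)
    from this(1) this(2)[of "e n"] show False
      by (simp add: P_def cinner_basis)
  qed
  ultimately show False
    using eq by simp
qed

section \<open>Upper bound: one limit suffices\<close>

text \<open>The tree only determines a class of indistinguishable matrices, so it may return an
  approximation of the spectrum of any representative of that class.\<close>

definition representative :: "nat \<Rightarrow> bool list \<Rightarrow> inf_matrix" where
  "representative n bs = (SOME y. outcomes (entry_tests n) y = bs)"

text \<open>The choice need not be effective: for fixed \<open>n\<close> only finitely many answer
  lists of the right length occur, and the chosen expressions are fixed parts of the leaves.\<close>

definition spectrum_output :: "nat \<Rightarrow> bool list \<Rightarrow> arith list" where
  "spectrum_output n bs =
     (SOME ps. approximates (1 / real (n + 1)) (spectrum (finite_section n (representative n bs))) ps)"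

definition spectrum_tree :: "nat \<Rightarrow> comp_tree" where
  "spectrum_tree n = decision_tree (entry_tests n) (spectrum_output n)"

lemma run_spectrum_tree:
  "run x (spectrum_tree n) = arith_val x ` set (spectrum_output n (outcomes (entry_tests n) x))"
  by (simp add: spectrum_tree_def run_decision_tree)

lemma approximates_spectrum_output:
  "approximates (1 / real (n + 1)) (spectrum (finite_section n (representative n bs))) (spectrum_output n bs)"
  unfolding spectrum_output_def
  by (rule someI_ex, rule compact_approximates[OF compact_spectrum[OF bounded_clinear_finite_section]]) simp

lemma outcomes_representative:
  "outcomes (entry_tests n) (representative n (outcomes (entry_tests n) x)) = outcomes (entry_tests n) x"
  unfolding representative_def
  by (rule someI[of "\<lambda>y. outcomes (entry_tests n) y = outcomes (entry_tests n) x" x]) simp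

text \<open>The matrix whose section the tree actually evaluates on \<open>T\<close>. Beyond its
  first \<open>n\<close> rows and columns it is arbitrary.\<close>

definition sampled :: "('a \<Rightarrow> 'a) \<Rightarrow> nat \<Rightarrow> inf_matrix" where
  "sampled T n = representative n (outcomes (entry_tests n) (Defs.truncate n (matrix_of e T)))"

text \<open>Once \<open>n\<close> exceeds a bound of \<open>T\<close>, all entries are in range of
  the grid and are met up to \<open>2 / (n+1)^3\<close>; the factor \<open>n^2\<close> leaves an
  error of at most \<open>2 / (n+1)\<close>.\<close>

lemma sampled_tendsto:
  assumes T: "compact_operator T" and "0 < \<epsilon>"
  shows "\<forall>\<^sub>F n in sequentially. \<forall>x. norm (finite_section n (sampled T n) x - T x) \<le> \<epsilon> * norm x"
proof -
  have lin: "bounded_clinear T"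
    using T by (simp add: compact_operator_def)
  obtain C where C: "0 < C" "\<And>x. norm (T x) \<le> C * norm x"
    using bounded_clinear_bound[OF lin] by blast
  have entry: "cmod (matrix_of e T i j) \<le> C" for i j
    using cinner_Cauchy_Schwarz[of "T (e j)" "e i"] C(2)[of "e j"] by (simp add: matrix_of_def)
  have "\<forall>\<^sub>F n in sequentially. C \<le> real n"
    by real_asymp
  moreover have "\<forall>\<^sub>F n in sequentially. 2 / real (n + 1) \<le> \<epsilon> / 2"
    using assms(2) by real_asymp
  moreover have "\<forall>\<^sub>F n in sequentially. \<forall>x. norm (finite_section n (matrix_of e T) x - T x) \<le> \<epsilon> / 2 * norm x"
    using assms(2) by (intro finite_section_tendsto[OF T]) simp
  ultimately show ?thesis
  proof eventually_elim
    case (elim n)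
    have eq: "outcomes (entry_tests n) (Defs.truncate n (matrix_of e T)) = outcomes (entry_tests n) (sampled T n)"
      by (simp add: sampled_def outcomes_representative)
    have diff: "cmod (sampled T n i j - matrix_of e T i j) \<le> 2 / real ((n + 1) ^ 3)" if "i < n" "j < n" for i j
    proof -
      have tr: "Defs.truncate n (matrix_of e T) i j = matrix_of e T i j"
        using that by (simp add: Defs.truncate_def)
      have "cmod (Defs.truncate n (matrix_of e T) i j) \<le> real n"
        using entry[of i j] elim(1) unfolding tr by linarith
      from outcomes_entry_tests[OF eq that this] show ?thesis
        by (simp add: tr norm_minus_commute)
    qed
    have "norm (finite_section n (sampled T n) x - T x) \<le> \<epsilon> * norm x" for x
    proof -
      have "norm (finite_section n (sampled T n) x - finite_section n (matrix_of e T) x)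
          \<le> (real n)\<^sup>2 * (2 / real ((n + 1) ^ 3)) * norm x"
        unfolding finite_section_diff by (rule norm_finite_section_le) (rule diff)
      also have "\<dots> \<le> \<epsilon> / 2 * norm x"
      proof (rule mult_right_mono)
        have cube: "N\<^sup>2 * (2 / N ^ 3) = 2 / N" if "N \<noteq> 0" for N :: real
          using that by (simp add: power2_eq_square power3_eq_cube)
        have "(real n)\<^sup>2 * (2 / real ((n + 1) ^ 3)) \<le> (real (n + 1))\<^sup>2 * (2 / real ((n + 1) ^ 3))"
          by (intro mult_right_mono power_mono) auto
        also have "\<dots> = 2 / real (n + 1)"
          unfolding of_nat_power by (rule cube) simp
        finally show "(real n)\<^sup>2 * (2 / real ((n + 1) ^ 3)) \<le> \<epsilon> / 2"
          using elim(2) by linarith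
      qed simp
      finally have "norm (finite_section n (sampled T n) x - finite_section n (matrix_of e T) x) \<le> \<epsilon> / 2 * norm x" .
      with elim(3) show ?thesis
        using norm_triangle_ineq[of "finite_section n (sampled T n) x - finite_section n (matrix_of e T) x"
            "finite_section n (matrix_of e T) x - T x"]
        by (smt (verit) diff_add_cancel add_diff_eq field_sum_of_halves distrib_right)
    qed
    then show ?case
      by blast
  qed
qed

lemma spectrum_tree_tendsto:
  assumes T: "compact_operator T"
  shows "aw_tendsto (\<lambda>n. run (Defs.truncate n (matrix_of e T)) (spectrum_tree n)) (spectrum T)"
  unfolding aw_tendsto_def
proof (rule LIMSEQ_I)
  fix \<epsilon> :: real assume "0 < \<epsilon>"
  have lin: "bounded_clinear T"
    using T by (simp add: compact_operator_def)
  define S where "S n = finite_section n (sampled T n)" for n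
  define \<Gamma> where "\<Gamma> n = run (Defs.truncate n (matrix_of e T)) (spectrum_tree n)" for n
  have S: "bounded_clinear (S n)" for n
    unfolding S_def by (rule bounded_clinear_finite_section)
  have lim: "\<forall>\<^sub>F n in sequentially. \<forall>x. norm (S n x - T x) \<le> \<eta> * norm x" if "0 < \<eta>" for \<eta>
    unfolding S_def by (rule sampled_tendsto[OF T that])
  have tail: "\<exists>m. \<forall>x. norm (T (x - proj m x)) \<le> \<eta> * norm x" if "0 < \<eta>" for \<eta>
    using compact_operator_proj_right[OF T that] by (auto simp: eventually_sequentially)
  have zero: "0 \<in> spectrum (S n)" for n
    unfolding S_def by (rule zero_in_spectrum_finite_section)
  have approx: "\<exists>k\<in>spectrum (S n). dist g k < 1 / real (n + 1)" if "g \<in> \<Gamma> n" for g n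
    using approximates_spectrum_output that
    unfolding \<Gamma>_def run_spectrum_tree S_def sampled_def approximates_def by blast
  have approx': "\<exists>g\<in>\<Gamma> n. dist g k < 1 / real (n + 1)" if "k \<in> spectrum (S n)" for k n
    using approximates_spectrum_output that
    unfolding \<Gamma>_def run_spectrum_tree S_def sampled_def approximates_def by blast
  \<comment> \<open>A quarter for approximating the spectrum of the rounded section and a quarter
    for its semicontinuity add up to \<open>\<epsilon> / 2\<close>, which makes the final bound
    strict.\<close>
  have \<epsilon>4: "0 < \<epsilon> / 4"
    using \<open>0 < \<epsilon>\<close> by simp
  have "\<forall>\<^sub>F n in sequentially. 1 / real (n + 1) < \<epsilon> / 4"
    using \<epsilon>4 by real_asymp
  moreover have "\<forall>\<^sub>F n in sequentially. \<forall>z\<in>spectrum (S n). \<exists>w\<in>spectrum T. dist z w < \<epsilon> / 4"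
    by (intro spectrum_upper_semicontinuous[OF lin S _ \<epsilon>4] lim)
  moreover have "\<forall>\<^sub>F n in sequentially. \<forall>w\<in>spectrum T. \<exists>z\<in>spectrum (S n). dist z w < \<epsilon> / 4"
    by (intro spectrum_lower_semicontinuous[OF lin S _ _ zero \<epsilon>4] lim tail)
  ultimately have "\<forall>\<^sub>F n in sequentially. norm (attouch_wets (\<Gamma> n) (spectrum T) - 0) < \<epsilon>"
  proof eventually_elim
    case (elim n)
    have 1: "\<exists>w\<in>spectrum T. dist g w \<le> \<epsilon> / 2" if g: "g \<in> \<Gamma> n" for g
    proof -
      obtain k where k: "k \<in> spectrum (S n)" "dist g k < 1 / real (n + 1)"
        using approx[OF g] by blast
      then obtain w where "w \<in> spectrum T" "dist k w < \<epsilon> / 4"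
        using elim(2) by blast
      then show ?thesis
        using k elim(1) dist_triangle[of g w k] by (intro bexI[of _ w]) auto
    qed
    have 2: "\<exists>g\<in>\<Gamma> n. dist g w \<le> \<epsilon> / 2" if w: "w \<in> spectrum T" for w
    proof -
      obtain k where k: "k \<in> spectrum (S n)" "dist k w < \<epsilon> / 4"
        using elim(3) w by blast
      then obtain g where "g \<in> \<Gamma> n" "dist g k < 1 / real (n + 1)"
        using approx' by blast
      then show ?thesis
        using k elim(1) dist_triangle[of g w k] by (intro bexI[of _ g]) auto
    qed
    \<comment> \<open>The spectral point 0 of the section forces an output, and hence a nearby point
      in the spectrum of \<open>T\<close>; the distance estimate needs both sets nonempty.\<close>
    have "\<Gamma> n \<noteq> {}"
      using approx'[OF zero] by blast
    moreover then have "spectrum T \<noteq> {}"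
      using 1 by blast
    ultimately show ?case
      using attouch_wets_le[of "\<Gamma> n" "spectrum T" "\<epsilon> / 2"] 1 2 \<open>0 < \<epsilon>\<close> by simp
  qed
  then show "\<exists>N. \<forall>n\<ge>N. norm (attouch_wets (run (Defs.truncate n (matrix_of e T)) (spectrum_tree n)) (spectrum T) - 0) < \<epsilon>"
    by (simp add: eventually_sequentially \<Gamma>_def)
qed

lemma closed_run: "closed (run x t)"
  by (induction t) (simp_all add: finite_imp_closed)

text \<open>The truncation size is the stage itself: \<open>hd [n] = n\<close> keeps all indices
  below \<open>n\<close>, the ones that \<open>entry_tests n\<close> reads. For order 1 there are no
  intermediate limits.\<close>

lemma estimating_functions_spectrum:
  "estimating_functions e {T. compact_operator T} spectrum 1 hd (\<lambda>ns x. run x (spectrum_tree (hd ns)))"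
  by (auto simp: estimating_functions_def closed_run finitely_evaluable_on_def visible_def
      spectrum_tree_tendsto)

end

theorem theorem4p1:
  fixes e :: "nat \<Rightarrow> 'a::complex_hilbert"
  assumes "orthonormal_basis e"
  shows "SCI e {T. compact_operator T} spectrum = 1"
proof -
  interpret hilbert_basis e
    by unfold_locales (rule assms)
  have "Inf {enat k |k. \<exists>N \<Gamma>. estimating_functions e {T. compact_operator T} spectrum k N \<Gamma>} = 1"
  proof (rule antisym)
    show "Inf {enat k |k. \<exists>N \<Gamma>. estimating_functions e {T. compact_operator T} spectrum k N \<Gamma>} \<le> 1"
      using estimating_functions_spectrum by (intro Inf_lower) (auto simp: one_enat_def)
    \<comment> \<open>Orders start at 1 by definition; the value 0 of the index is excluded
      separately by \<open>not_exactly_computable\<close>.\<close>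
    show "1 \<le> Inf {enat k |k. \<exists>N \<Gamma>. estimating_functions e {T. compact_operator T} spectrum k N \<Gamma>}"
      by (rule Inf_greatest) (auto simp: one_enat_def estimating_functions_def)
  qed
  then show ?thesis
    by (simp add: SCI_def not_exactly_computable)
qed

end
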